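(* Every $3$-algebraic tangle can be reduced, in the cubic skein module of $3$-tangles, to a linear combination (with coefficients in $R$) of the following $40$ basic $3$-tangles. Invertible ($24$ elements, forming the set $\mathcal{B}_3$): $e$; $S_1, S_1^{-1}, S_2, S_2^{-1}$; $S_1S_2,\ S_1S_2^{-1},\ S_1^{-1}S_2,\ S_1^{-1}S_2^{-1},\ S_2S_1,\ S_2S_1^{-1},\ S_2^{-1}S_1,\ S_2^{-1}S_1^{-1}$; $S_1^{\epsilon_1}S_2^{\epsilon_2}S_1^{\epsilon_3}$ for all $\epsilon_1,\epsilon_2,\epsilon_3\in\{1,-1\}$; $S_2S_1^{-1}S_2,\ S_2^{-1}S_1S_2^{-1}$; $(S_1S_2^{-1})^2$. Non-invertible ($16$ elements, forming the set $\mathcal{C}_3$): $U_1,\ U_2$; $U_1U_2,\ U_2U_1$; $S_1U_2,\ S_1^{-1}U_2,\ S_2U_1,\ S_2^{-1}U_1,\ U_2S_1,\ U_2S_1^{-1},\ U_1S_2,\ U_1S_2^{-1}$; $S_1^{\epsilon_1}U_2S_1^{\epsilon_2}$ for all $\epsilon_1,\epsilon_2\in\{1,-1\}$.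
   Context: Ring: $R=\mathbb{Z}[b_0^{\pm1},b_1,b_2,b_3^{\pm1},b_\infty^{\pm1},a^{\pm1}]$. Tangles $D_n$: in an oriented ball $B^3=B^2\times I$ with four boundary points NW, NE, SW, SE, $D_0$ is the $2$-tangle of two horizontal arcs (NW to NE, SW to SE), $D_\infty$ is the $2$-tangle of two vertical arcs (NW to SW, NE to SE), and for $n\in\mathbb{Z}$, $D_n$ is two horizontal strands twisted by $n$ right-handed half-twists ($|n|$ left-handed ones if $n<0$). All diagrams carry the blackboard framing. An $n$-tangle is a tangle in a ball $B^2 \times I$ with $2n$ fixed boundary points on the circle $\partial B^2\times\{1/2\}$ ($n$ on the left, $n$ on the right), unoriented, framed, considered up to ambient isotopy fixing the boundary. The cubic skein module of $n$-tangles is the free $R$-module on $n$-tangles modulo the local skein relation $b_0D_0+b_1D_1+b_2D_2+b_3D_3+b_\infty D_\infty=0$ (applied inside small balls, the tangles being identical outside), the framing relation $D^{(1)}=aD$ ($D^{(1)}$ is $D$ with one positive full twist added to its framing), and $D\sqcup\bigcirc=tD$ with $t=-(b_0+b_1a^{-1}+b_2a^{-2}+b_3a^{-3})/b_\infty$. Multiplication $P_1P_2$ is horizontal concatenation ($P_1$ on the left of $P_2$). Basic generators for $n=3$: $e$ is the identity $3$-tangle (three horizontal strands numbered from the top); $S_i$ ($i=1,2$) is a single crossing $D_1$ between strands $i$ and $i+1$, and $S_i^{-1}$ is the opposite crossing; $U_i$ is $D_\infty$ placed on strands $i$ and $i+1$ (the other strand is horizontal). $n$-algebraic tangles are defined recursively: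 (i) an $n$-tangle (diagram) with no more than one crossing is $n$-algebraic; (ii) if $P_1$ and $P_2$ are $n$-algebraic tangles, then $r^i(P_1)r^j(P_2)$ is $n$-algebraic for all $i,j$, where $r$ denotes rotation about the $z$-axis (perpendicular to the plane of projection) by the angle $2\pi/2n$. *)

theory Defs
  imports Complex_Main "HOL-Library.Poly_Mapping" "HOL-Library.Product_Plus"
begin

section \<open>The coefficient ring\<close>

text \<open>
  The ring of integral Laurent polynomials in \<open>b0\<close>, \<open>b1\<close>, \<open>b2\<close>, \<open>b3\<close>, \<open>binf\<close>, \<open>a\<close> in which all
  variables except \<open>b1\<close> and \<open>b2\<close> are invertible, as the monoid ring over the integers of the
  additive monoid of exponent vectors.
\<close>

type_synonym expo = "int \<times> nat \<times> nat \<times> int \<times> int \<times> int"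
type_synonym R = "expo \<Rightarrow>\<^sub>0 int"

definition monomial :: "expo \<Rightarrow> R" where
  "monomial v = Poly_Mapping.single v 1"

definition b0 :: R where "b0 = monomial (1, 0, 0, 0, 0, 0)"
definition b1 :: R where "b1 = monomial (0, 1, 0, 0, 0, 0)"
definition b2 :: R where "b2 = monomial (0, 0, 1, 0, 0, 0)"
definition b3 :: R where "b3 = monomial (0, 0, 0, 1, 0, 0)"
definition binf :: R where "binf = monomial (0, 0, 0, 0, 1, 0)"
definition binf_inv :: R where "binf_inv = monomial (0, 0, 0, 0, -1, 0)"
definition a_unit :: R where "a_unit = monomial (0, 0, 0, 0, 0, 1)"
definition a_unit_inv :: R where "a_unit_inv = monomial (0, 0, 0, 0, 0, -1)"

definition t_circle :: R where
  "t_circle = - (b0 + b1 * a_unit_inv + b2 * a_unit_inv ^ 2 + b3 * a_unit_inv ^ 3) * binf_inv"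


section \<open>Tangle diagrams\<close>

text \<open>
  Unoriented tangle diagrams, in general position with respect to the horizontal coordinate,
  are read from left to right as words of elementary slices.  A slice \<open>(f, i)\<close> has \<open>i\<close> horizontal
  strands above the elementary piece \<open>f\<close>, and the remaining strands run horizontally below it.
  Strands are counted from the top, starting at 0.

  \<^item> \<open>Cup\<close> is the arc open to the right: it creates two adjacent strands;
  \<^item> \<open>Cap\<close> is the arc open to the left: it joins two adjacent strands;
  \<^item> \<open>Cross True\<close> is the right-handed half twist of two horizontal strands (the strand
    from upper left to lower right is on top; the crossing is positive if both strands are oriented
    from left to right), and \<open>Cross False\<close> is the left-handed one.
\<close>

datatype piece = Cup | Cap | Cross bool

type_synonym slice = "piece \<times> nat"
type_synonym diagram = "slice list"

fun ins :: "piece \<Rightarrow> nat" where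
  "ins Cup = 0" | "ins Cap = 2" | "ins (Cross _) = 2"

fun outs :: "piece \<Rightarrow> nat" where
  "outs Cup = 2" | "outs Cap = 0" | "outs (Cross _) = 2"

inductive runs :: "nat \<Rightarrow> diagram \<Rightarrow> nat \<Rightarrow> bool" where
  runs_Nil: "runs m [] m"
| runs_Cons: "i + ins f \<le> m \<Longrightarrow> runs (m - ins f + outs f) d n \<Longrightarrow> runs m ((f, i) # d) n"

lemma runs_Nil_iff [simp]: "runs m [] n \<longleftrightarrow> m = n"
  by (auto intro: runs.intros elim: runs.cases)

lemma runs_Cons_iff [simp]:
  "runs m ((f, i) # d) n \<longleftrightarrow> i + ins f \<le> m \<and> runs (m - ins f + outs f) d n"
  by (auto intro: runs.intros elim: runs.cases)

definition diagrams :: "nat \<Rightarrow> diagram set" where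
  "diagrams n = {d. runs n d n}"

fun is_crossing :: "slice \<Rightarrow> bool" where
  "is_crossing (Cross _, _) = True"
| "is_crossing _ = False"

definition crossings :: "diagram \<Rightarrow> nat" where
  "crossings d = length (filter is_crossing d)"


text \<open>
  The 2-tangles \<open>D\<^sub>m\<close> for \<open>m \<ge> 0\<close> and \<open>D\<^sub>\<infinity>\<close>, placed below \<open>k\<close> horizontal strands.
\<close>

definition twist :: "nat \<Rightarrow> nat \<Rightarrow> diagram" where
  "twist m k = replicate m (Cross True, k)"

definition twist_inf :: "nat \<Rightarrow> diagram" where
  "twist_inf k = [(Cap, k), (Cup, k)]"


section \<open>Framed tangles\<close>

text \<open>
  Ambient isotopy (fixing the boundary) of framed tangles with blackboard framing, as the
  equivalence of diagrams given by the Reidemeister theorem for sliced diagrams: it is generated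
  by planar isotopy (\<open>exchange\<close>, \<open>zigzag\<close>, \<open>slide\<close>), the second and third
  Reidemeister moves, and the framed first Reidemeister move \<open>curl\<close>, which identifies the two
  curls with the same contribution to the framing but opposite rotation numbers.
\<close>

inductive move :: "diagram \<Rightarrow> diagram \<Rightarrow> bool" where
  exchange: "move [(f, i), (g, i + outs f + k)] [(g, i + ins f + k), (f, i)]"
| zigzag1: "move [(Cup, i), (Cap, i + 1)] []"
| zigzag2: "move [(Cup, i + 1), (Cap, i)] []"
| slide_cap: "move [(Cross s, i), (Cap, i + 1)] [(Cross (\<not> s), i + 1), (Cap, i)]"
| slide_cup: "move [(Cup, i + 1), (Cross s, i)] [(Cup, i), (Cross (\<not> s), i + 1)]"
| curl: "move [(Cup, i + 1), (Cross s, i), (Cap, i + 1)] [(Cup, i), (Cross s, i + 1), (Cap, i)]"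
| reid2: "move [(Cross s, i), (Cross (\<not> s), i)] []"
| reid3: "move [(Cross s, i), (Cross s, i + 1), (Cross s, i)]
               [(Cross s, i + 1), (Cross s, i), (Cross s, i + 1)]"

inductive isotopic :: "nat \<Rightarrow> diagram \<Rightarrow> diagram \<Rightarrow> bool" for n where
  isotopic_refl: "d \<in> diagrams n \<Longrightarrow> isotopic n d d"
| isotopic_move: "move u v \<Longrightarrow> A @ u @ B \<in> diagrams n \<Longrightarrow> A @ v @ B \<in> diagrams n
    \<Longrightarrow> isotopic n (A @ u @ B) (A @ v @ B)"
| isotopic_sym: "isotopic n d d' \<Longrightarrow> isotopic n d' d"
| isotopic_trans: "isotopic n d d' \<Longrightarrow> isotopic n d' d'' \<Longrightarrow> isotopic n d d''"

type_synonym tangle = "diagram set"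

definition tangle :: "nat \<Rightarrow> diagram \<Rightarrow> tangle" where
  "tangle n d = {d'. isotopic n d d'}"


section \<open>The cubic skein module\<close>

definition scale :: "R \<Rightarrow> (tangle \<Rightarrow>\<^sub>0 R) \<Rightarrow> (tangle \<Rightarrow>\<^sub>0 R)" where
  "scale c x = Poly_Mapping.map ((*) c) x"

lemma lookup_scale [simp]: "Poly_Mapping.lookup (scale c x) T = c * Poly_Mapping.lookup x T"
  by (simp add: scale_def Poly_Mapping.map.rep_eq when_def)

global_interpretation free: module scale
  by unfold_locales (auto intro!: poly_mapping_eqI simp: lookup_add algebra_simps)

definition gen :: "nat \<Rightarrow> diagram \<Rightarrow> tangle \<Rightarrow>\<^sub>0 R" where
  "gen n d = Poly_Mapping.single (tangle n d) 1"

text \<open>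
  In each relation, the part of the tangle outside the small ball is given by the words \<open>A\<close> and
  \<open>B\<close>; the ball lies between them, where \<open>w\<close> strands run and \<open>k\<close> of them pass above it.  Every
  ball in which a tangle has the prescribed shape can be brought into such a position by an
  isotopy.  The curl in \<open>framing\<close> has a positive crossing, so it adds one positive full twist.
\<close>

inductive_set relators :: "nat \<Rightarrow> (tangle \<Rightarrow>\<^sub>0 R) set" for n where
  skein: "runs n A w \<Longrightarrow> k + 2 \<le> w \<Longrightarrow> runs w B n \<Longrightarrow>
    scale b0 (gen n (A @ twist 0 k @ B))
    + scale b1 (gen n (A @ twist 1 k @ B))
    + scale b2 (gen n (A @ twist 2 k @ B))
    + scale b3 (gen n (A @ twist 3 k @ B))
    + scale binf (gen n (A @ twist_inf k @ B)) \<in> relators n"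
| framing: "runs n A w \<Longrightarrow> k + 1 \<le> w \<Longrightarrow> runs w B n \<Longrightarrow>
    gen n (A @ [(Cup, k + 1), (Cross True, k), (Cap, k + 1)] @ B)
    - scale a_unit (gen n (A @ B)) \<in> relators n"
| circle: "runs n A w \<Longrightarrow> k \<le> w \<Longrightarrow> runs w B n \<Longrightarrow>
    gen n (A @ [(Cup, k), (Cap, k)] @ B) - scale t_circle (gen n (A @ B)) \<in> relators n"

text \<open>Equality of the classes of \<open>x\<close> and \<open>y\<close> in the cubic skein module of \<open>n\<close>-tangles.\<close>

definition skein_eq :: "nat \<Rightarrow> (tangle \<Rightarrow>\<^sub>0 R) \<Rightarrow> (tangle \<Rightarrow>\<^sub>0 R) \<Rightarrow> bool" where
  "skein_eq n x y \<longleftrightarrow> x - y \<in> free.span (relators n)"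


section \<open>Algebraic tangles\<close>

text \<open>
  Counterclockwise rotation of the boundary by one step: the upper right end point is bent over the
  top of the diagram to become the upper left one, and the lower left end point is bent below the
  diagram to become the lower right one.
\<close>

definition rot :: "nat \<Rightarrow> diagram \<Rightarrow> diagram" where
  "rot n d = [(Cup, n)] @ map (\<lambda>(f, i). (f, i + 1)) d @ [(Cap, 0)]"

inductive_set algebraic :: "nat \<Rightarrow> tangle set" for n where
  few_crossings: "d \<in> diagrams n \<Longrightarrow> crossings d \<le> 1 \<Longrightarrow> tangle n d \<in> algebraic n"
| product: "d \<in> diagrams n \<Longrightarrow> d' \<in> diagrams n \<Longrightarrow>
    tangle n d \<in> algebraic n \<Longrightarrow> tangle n d' \<in> algebraic n \<Longrightarrow>
    tangle n ((rot n ^^ i) d @ (rot n ^^ j) d') \<in> algebraic n"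


section \<open>Basic 3-tangles\<close>

text \<open>The index \<open>i \<in> {1, 2}\<close> counts strands from 1, whereas positions of slices start at 0.\<close>

definition S :: "nat \<Rightarrow> bool \<Rightarrow> diagram" where
  "S i s = [(Cross s, i - 1)]"

definition U :: "nat \<Rightarrow> diagram" where
  "U i = twist_inf (i - 1)"

definition basic_inv :: "diagram set" where
  "basic_inv = {[]}
    \<union> {S 1 s | s. True} \<union> {S 2 s | s. True}
    \<union> {S 1 s @ S 2 s' | s s'. True} \<union> {S 2 s @ S 1 s' | s s'. True}
    \<union> {S 1 s @ S 2 s' @ S 1 s'' | s s' s''. True}
    \<union> {S 2 True @ S 1 False @ S 2 True, S 2 False @ S 1 True @ S 2 False}
    \<union> {S 1 True @ S 2 False @ S 1 True @ S 2 False}"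

definition basic_noninv :: "diagram set" where
  "basic_noninv = {U 1, U 2} \<union> {U 1 @ U 2, U 2 @ U 1}
    \<union> {S 1 s @ U 2 | s. True} \<union> {S 2 s @ U 1 | s. True}
    \<union> {U 2 @ S 1 s | s. True} \<union> {U 1 @ S 2 s | s. True}
    \<union> {S 1 s @ U 2 @ S 1 s' | s s'. True}"

lemma card_basic_inv: "card basic_inv = 24"
  by (simp add: basic_inv_def S_def ex_bool_eq Collect_disj_eq)

lemma card_basic_noninv: "card basic_noninv = 16"
  by (simp add: basic_noninv_def S_def U_def twist_inf_def ex_bool_eq Collect_disj_eq)

lemma basic_disjoint: "basic_inv \<inter> basic_noninv = {}"
  by (auto simp: basic_inv_def basic_noninv_def S_def U_def twist_inf_def)

lemma basic_diagrams: "basic_inv \<union> basic_noninv \<subseteq> diagrams 3"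
  by (auto simp: basic_inv_def basic_noninv_def S_def U_def twist_inf_def diagrams_def)

end

theory Submission
  imports Defs
begin

text \<open>
  The span of the basic tangles is closed under the two operations that build algebraic tangles,
  and contains the tangles with at most one crossing.

  A word in \<open>S\<^sub>i\<close> and \<open>U\<^sub>i\<close> that contains a hook \<open>U\<^sub>i\<close> factors through a single strand. The
  \<open>3\<close>-to-\<open>1\<close> tangles are spanned by four of them (they are rotated \<open>2\<close>-tangles), and so are the
  \<open>1\<close>-to-\<open>3\<close> tangles; the sixteen products are the non-invertible basic tangles. Modulo these,
  the skein relation is the cubic Hecke relation, and the invertible basic tangles span the
  cubic Hecke algebra of the braid group on three strands.

  Rotation turns \<open>S\<^sub>1 d\<close> into \<open>S\<^sub>2 r(d)\<close> and \<open>d S\<^sub>2\<close> into \<open>r(d) S\<^sub>1\<close>, and likewise for hooks, so that only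
  few rotations have to be computed. A diagram with at most one crossing is simplified at a
  local maximum of its width: a cup followed by at most one crossing and a cap can always be
  replaced by something narrower.
\<close>

section \<open>Diagrams and the skein module\<close>

lemma runs_append: "runs m (A @ B) n \<longleftrightarrow> (\<exists>w. runs m A w \<and> runs w B n)"
proof (induction A arbitrary: m)
  case (Cons s A)
  then show ?case by (cases s) (simp add: conj_assoc)
qed simp

lemma runs_appendI: "runs m A w \<Longrightarrow> runs w B n \<Longrightarrow> runs m (A @ B) n"
  by (auto simp: runs_append)

lemma tangle_eqI:
  assumes "isotopic n d d'"
  shows "tangle n d = tangle n d'"
  using assms unfolding tangle_def by (blast intro: isotopic_sym isotopic_trans)

lemma tangle_eqD: "tangle n d = tangle n d' \<Longrightarrow> d' \<in> diagrams n \<Longrightarrow> isotopic n d d'"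
  unfolding tangle_def using isotopic_refl by blast

lemma gen_move:
  assumes "move u v" "runs n A w" "runs w u w'" "runs w v w'" "runs w' B n"
  shows "gen n (A @ u @ B) = gen n (A @ v @ B)"
proof -
  have "A @ u @ B \<in> diagrams n" "A @ v @ B \<in> diagrams n"
    using assms(2-) by (auto simp: diagrams_def runs_append)
  with assms(1) show ?thesis
    unfolding gen_def by (metis isotopic_move tangle_eqI)
qed

text \<open>The relators belong to the spanning set, so this says that the class of \<open>d\<close>
  in the skein module lies in the span of the classes of \<open>Bs\<close>, without a quotient being
  formed.\<close>

definition reduces :: "nat \<Rightarrow> diagram set \<Rightarrow> diagram \<Rightarrow> bool" where
  "reduces n Bs d \<longleftrightarrow> gen n d \<in> free.span (relators n \<union> gen n ` Bs)"

lemma reduces_basis: "d \<in> Bs \<Longrightarrow> reduces n Bs d"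
  unfolding reduces_def by (auto intro: free.span_base)

lemma reduces_move:
  assumes "move u v" "runs n A w" "runs w u w'" "runs w v w'" "runs w' B n"
  shows "reduces n Bs (A @ u @ B) \<longleftrightarrow> reduces n Bs (A @ v @ B)"
  unfolding reduces_def using gen_move[OF assms] by simp

lemma relator_span: "x \<in> relators n \<Longrightarrow> x \<in> free.span (relators n \<union> V)"
  by (auto intro: free.span_base)

lemma reduces_scalar:
  assumes "gen n d - scale c (gen n d') \<in> relators n" "reduces n Bs d'"
  shows "reduces n Bs d"
proof -
  have "gen n d - scale c (gen n d') + scale c (gen n d') \<in> free.span (relators n \<union> gen n ` Bs)"
    using assms relator_span unfolding reduces_def by (intro free.span_add free.span_scale) auto
  then show ?thesis unfolding reduces_def by simp
qed

lemma monomial_mult: "monomial v * monomial w = monomial (v + w)"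
  by (simp add: monomial_def mult_single)

lemma monomial_zero: "monomial 0 = 1"
  by (simp add: monomial_def)

text \<open>With \<open>b0\<close> and \<open>b3\<close> invertible the skein relation can be solved
  for either end term, \<open>D_0\<close> or \<open>D_3\<close>; with \<open>a_unit\<close>
  invertible a curl can be inserted as well as removed.\<close>

lemma unit_b0: "monomial (-1, 0, 0, 0, 0, 0) * b0 = 1"
  and unit_b3: "monomial (0, 0, 0, -1, 0, 0) * b3 = 1"
  and unit_a: "a_unit_inv * a_unit = 1"
  unfolding b0_def b3_def a_unit_def a_unit_inv_def
  by (simp_all add: monomial_mult plus_prod_def flip: monomial_zero zero_prod_def)

lemma span_unit:
  assumes "u * c = 1" "scale c x \<in> free.span V"
  shows "x \<in> free.span V"
  using free.span_scale[OF assms(2), of u] assms(1) by simp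

lemma reduces_unit_scalar:
  assumes "gen n d - scale c (gen n d') \<in> relators n" "u * c = 1"
  shows "reduces n Bs d \<longleftrightarrow> reduces n Bs d'"
proof
  assume "reduces n Bs d"
  then have "gen n d - (gen n d - scale c (gen n d')) \<in> free.span (relators n \<union> gen n ` Bs)"
    using relator_span[OF assms(1)] unfolding reduces_def by (rule free.span_diff)
  then show "reduces n Bs d'" unfolding reduces_def using span_unit[OF assms(2)] by simp
qed (rule reduces_scalar[OF assms(1)])

lemma reduces_circle:
  assumes "runs n A w" "k \<le> w" "runs w B n" "reduces n Bs (A @ B)"
  shows "reduces n Bs (A @ [(Cup, k), (Cap, k)] @ B)"
  using reduces_scalar[OF relators.circle[OF assms(1-3)] assms(4)] .

section \<open>Kinks\<close>

text \<open>A cup with a left-handed kink is isotopic to a cup whose upper strand carries a positive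
  curl, so by the framing relation the two diagrams differ by a unit.\<close>

lemma reduces_kink_cup_False:
  assumes A: "runs n A w" and i: "i \<le> w" and B: "runs (w + 2) B n"
  shows "reduces n Bs (A @ [(Cup, i), (Cross False, i)] @ B) \<longleftrightarrow> reduces n Bs (A @ [(Cup, i)] @ B)"
proof -
  let ?C = "A @ [(Cup, i)]"
  have C: "runs n ?C (w + 2)" using A i by (auto simp: runs_append)
  have "reduces n Bs (A @ [(Cup, i)] @ B) \<longleftrightarrow>
      reduces n Bs (?C @ [(Cup, i + 1), (Cross True, i), (Cap, i + 1)] @ B)"
    using reduces_unit_scalar[OF relators.framing[OF C _ B, of i] unit_a] i by simp
  also have "\<dots> \<longleftrightarrow> reduces n Bs (?C @ [(Cup, i), (Cross True, i + 1), (Cap, i)] @ B)"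
    by (rule reduces_move[OF curl C _ _ B]) (use i in auto)
  also have "\<dots> \<longleftrightarrow> reduces n Bs (A @ [(Cup, i), (Cup, i)] @ [(Cross True, i + 1), (Cap, i)] @ B)"
    by simp
  \<comment> \<open>The cup of the curl lies above the old one; creating it first moves the old cup
    from position \<open>i\<close> to \<open>i + 2\<close>.\<close>
  also have "\<dots> \<longleftrightarrow> reduces n Bs (A @ [(Cup, i), (Cup, i + 2)] @ [(Cross True, i + 1), (Cap, i)] @ B)"
    using move.exchange[of Cup i Cup 0] i B
    by (intro reduces_move[OF _ A, of _ _ "w + 4", symmetric]) auto
  also have "\<dots> \<longleftrightarrow> reduces n Bs (?C @ [(Cup, i + 2), (Cross True, i + 1)] @ [(Cap, i)] @ B)"
    by simp
  also have "\<dots> \<longleftrightarrow> reduces n Bs (?C @ [(Cup, i + 1), (Cross False, i + 2)] @ [(Cap, i)] @ B)"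
    using move.slide_cup[of "i + 1" True] i B
    by (intro reduces_move[OF _ C, of _ _ "w + 4"]) auto
  also have "\<dots> \<longleftrightarrow> reduces n Bs ((?C @ [(Cup, i + 1)]) @ [(Cross False, i + 2), (Cap, i)] @ B)"
    by simp
  also have "\<dots> \<longleftrightarrow> reduces n Bs ((?C @ [(Cup, i + 1)]) @ [(Cap, i), (Cross False, i)] @ B)"
    using move.exchange[of Cap i "Cross False" 0] i B A
    by (intro reduces_move[of _ _ _ _ "w + 4" "w + 2", symmetric]) (auto simp: runs_append)
  also have "\<dots> \<longleftrightarrow> reduces n Bs (?C @ [(Cup, i + 1), (Cap, i)] @ [(Cross False, i)] @ B)"
    by simp
  also have "\<dots> \<longleftrightarrow> reduces n Bs (?C @ [] @ [(Cross False, i)] @ B)"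
    using i B by (intro reduces_move[OF zigzag2 C, of _ "w + 2"]) auto
  finally show ?thesis by simp
qed

text \<open>Mirror image of the previous argument: the curl now sits on the upper strand running
  into the cap.\<close>

lemma reduces_kink_cap_False:
  assumes A: "runs n A (w + 2)" and i: "i \<le> w" and B: "runs w B n"
  shows "reduces n Bs (A @ [(Cross False, i), (Cap, i)] @ B) \<longleftrightarrow> reduces n Bs (A @ [(Cap, i)] @ B)"
proof -
  let ?C = "[(Cap, i)] @ B"
  have C: "runs (w + 2) ?C n" using B i by (auto simp: runs_append)
  have "reduces n Bs (A @ [(Cap, i)] @ B) \<longleftrightarrow>
      reduces n Bs (A @ [(Cup, i + 1), (Cross True, i), (Cap, i + 1)] @ ?C)"
    using reduces_unit_scalar[OF relators.framing[OF A _ C, of i] unit_a] i by simp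
  also have "\<dots> \<longleftrightarrow> reduces n Bs (A @ [(Cup, i), (Cross True, i + 1), (Cap, i)] @ ?C)"
    by (rule reduces_move[OF curl A _ _ C]) (use i in auto)
  also have "\<dots> \<longleftrightarrow> reduces n Bs ((A @ [(Cup, i), (Cross True, i + 1)]) @ [(Cap, i), (Cap, i)] @ B)"
    by simp
  also have "\<dots> \<longleftrightarrow> reduces n Bs ((A @ [(Cup, i), (Cross True, i + 1)]) @ [(Cap, i + 2), (Cap, i)] @ B)"
    using move.exchange[of Cap i Cap 0] i B A
    by (intro reduces_move[of _ _ _ _ "w + 4" w]) (auto simp: runs_append)
  also have "\<dots> \<longleftrightarrow> reduces n Bs ((A @ [(Cup, i)]) @ [(Cross True, i + 1), (Cap, i + 2)] @ ?C)"
    by simp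
  also have "\<dots> \<longleftrightarrow> reduces n Bs ((A @ [(Cup, i)]) @ [(Cross False, i + 2), (Cap, i + 1)] @ ?C)"
    using move.slide_cap[of True "i + 1"] i B A
    by (intro reduces_move[of _ _ _ _ "w + 4" "w + 2"]) (auto simp: runs_append)
  also have "\<dots> \<longleftrightarrow> reduces n Bs (A @ [(Cup, i), (Cross False, i + 2)] @ [(Cap, i + 1)] @ ?C)"
    by simp
  also have "\<dots> \<longleftrightarrow> reduces n Bs (A @ [(Cross False, i), (Cup, i)] @ [(Cap, i + 1)] @ ?C)"
    using move.exchange[of Cup i "Cross False" 0] i B A
    by (intro reduces_move[of _ _ _ _ "w + 2" "w + 4"]) (auto simp: runs_append)
  also have "\<dots> \<longleftrightarrow> reduces n Bs ((A @ [(Cross False, i)]) @ [(Cup, i), (Cap, i + 1)] @ ?C)"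
    by simp
  also have "\<dots> \<longleftrightarrow> reduces n Bs ((A @ [(Cross False, i)]) @ [] @ ?C)"
    using i A B by (intro reduces_move[OF zigzag1, where w = "w + 2" and w' = "w + 2"]) (auto simp: runs_append)
  finally show ?thesis by simp
qed

lemma reduces_cancel:
  assumes "runs n A w" "i + 2 \<le> w" "runs w B n"
  shows "reduces n Bs (A @ [(Cross (\<not> s), i), (Cross s, i)] @ B) \<longleftrightarrow> reduces n Bs (A @ B)"
    and "reduces n Bs (A @ [(Cross s, i), (Cross (\<not> s), i)] @ B) \<longleftrightarrow> reduces n Bs (A @ B)"
proof -
  have "runs w [(Cross s, i), (Cross s', i)] w" for s s' using assms(2) by auto
  then show "reduces n Bs (A @ [(Cross (\<not> s), i), (Cross s, i)] @ B) \<longleftrightarrow> reduces n Bs (A @ B)"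
    and "reduces n Bs (A @ [(Cross s, i), (Cross (\<not> s), i)] @ B) \<longleftrightarrow> reduces n Bs (A @ B)"
    using reduces_move[OF reid2[of "\<not> s" i] assms(1) _ _ assms(3), of Bs]
      reduces_move[OF reid2[of s i] assms(1) _ _ assms(3), of Bs] by simp_all
qed

lemma reduces_kink_cup:
  assumes A: "runs n A w" and i: "i \<le> w" and B: "runs (w + 2) B n"
  shows "reduces n Bs (A @ [(Cup, i), (Cross s, i)] @ B) \<longleftrightarrow> reduces n Bs (A @ [(Cup, i)] @ B)"
proof (cases s)
  case True
  \<comment> \<open>The left-handed case, read backwards, inserts a crossing that cancels the
    right-handed one.\<close>
  have "reduces n Bs (A @ [(Cup, i), (Cross True, i)] @ B) \<longleftrightarrow>
      reduces n Bs (A @ [(Cup, i), (Cross False, i)] @ [(Cross True, i)] @ B)"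
    using reduces_kink_cup_False[of n A w i "[(Cross True, i)] @ B" Bs] assms by simp
  also have "\<dots> \<longleftrightarrow> reduces n Bs (A @ [(Cup, i)] @ B)"
    using reduces_cancel(1)[of n "A @ [(Cup, i)]" "w + 2" i B Bs True] assms by (auto simp: runs_append)
  finally show ?thesis using True by simp
qed (use reduces_kink_cup_False[OF assms] in simp)

lemma reduces_kink_cap:
  assumes A: "runs n A (w + 2)" and i: "i \<le> w" and B: "runs w B n"
  shows "reduces n Bs (A @ [(Cross s, i), (Cap, i)] @ B) \<longleftrightarrow> reduces n Bs (A @ [(Cap, i)] @ B)"
proof (cases s)
  case True
  have "reduces n Bs (A @ [(Cross True, i), (Cap, i)] @ B) \<longleftrightarrow>
      reduces n Bs ((A @ [(Cross True, i)]) @ [(Cross False, i), (Cap, i)] @ B)"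
    using reduces_kink_cap_False[of n "A @ [(Cross True, i)]" w i B Bs] assms
      runs_appendI[OF A, of "[(Cross True, i)]" "w + 2"] by simp
  also have "\<dots> \<longleftrightarrow> reduces n Bs (A @ [(Cap, i)] @ B)"
    using reduces_cancel(2)[of n A "w + 2" i "[(Cap, i)] @ B" Bs True] assms by auto
  finally show ?thesis using True by simp
qed (use reduces_kink_cap_False[OF assms] in simp)

section \<open>The cubic relation\<close>

text \<open>Once the middle terms and the hook are reduced, the skein relation leaves
  \<open>b0 D_0 + b3 D_3\<close>, and both coefficients are units.\<close>

lemma reduces_twist:
  assumes A: "runs n A w" and k: "k + 2 \<le> w" and B: "runs w B n"
    and U: "reduces n Bs (A @ twist_inf k @ B)"
    and 1: "reduces n Bs (A @ twist 1 k @ B)" and 2: "reduces n Bs (A @ twist 2 k @ B)"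
  shows "reduces n Bs (A @ twist 0 k @ B) \<longleftrightarrow> reduces n Bs (A @ twist 3 k @ B)"
proof -
  let ?g = "\<lambda>m. gen n (A @ twist m k @ B)" and ?V = "free.span (relators n \<union> gen n ` Bs)"
  let ?r = "scale b0 (?g 0) + scale b1 (?g 1) + scale b2 (?g 2) + scale b3 (?g 3)
    + scale binf (gen n (A @ twist_inf k @ B))"
  let ?m = "scale b1 (?g 1) + scale b2 (?g 2) + scale binf (gen n (A @ twist_inf k @ B))"
  have r: "?r \<in> ?V" using relators.skein[OF A k B] by (rule relator_span)
  have m: "?m \<in> ?V" using U 1 2 unfolding reduces_def
    by (intro free.span_add free.span_scale)
  have rm: "?r - ?m \<in> ?V" using r m by (rule free.span_diff)
  have e: "?r - ?m = scale b0 (?g 0) + scale b3 (?g 3)" by (simp add: algebra_simps)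
  show ?thesis
  proof
    assume "reduces n Bs (A @ twist 0 k @ B)"
    then have "?r - ?m - scale b0 (?g 0) \<in> ?V"
      unfolding reduces_def by (intro free.span_diff[OF rm] free.span_scale)
    then show "reduces n Bs (A @ twist 3 k @ B)"
      unfolding reduces_def e by - (rule span_unit[OF unit_b3], simp)
  next
    assume "reduces n Bs (A @ twist 3 k @ B)"
    then have "?r - ?m - scale b3 (?g 3) \<in> ?V"
      unfolding reduces_def by (intro free.span_diff[OF rm] free.span_scale)
    then show "reduces n Bs (A @ twist 0 k @ B)"
      unfolding reduces_def e by - (rule span_unit[OF unit_b0], simp)
  qed
qed

text \<open>Multiplying the skein relation by one or two left-handed crossings shifts the exponents
  0 to 3 to -1 to 2 (for \<open>s\<close> true) or -2 to 1 (for \<open>s\<close> false). The extra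
  crossings are kinks in front of the hook, which absorbs them up to a unit.\<close>

lemma reduces_cubic:
  assumes A: "runs n A w" and k: "k + 2 \<le> w" and B: "runs w B n"
    and U: "reduces n Bs (A @ [(Cap, k), (Cup, k)] @ B)"
    and 0: "reduces n Bs (A @ B)" and 1: "reduces n Bs (A @ [(Cross s, k)] @ B)"
  shows "reduces n Bs (A @ [(Cross s, k), (Cross s, k)] @ B) \<longleftrightarrow>
    reduces n Bs (A @ [(Cross (\<not> s), k)] @ B)"
proof -
  let ?F = "(Cross False, k)" and ?T = "(Cross True, k)"
  have AF: "runs n (A @ [?F]) w" using A k by (auto simp: runs_append)
  have AFF: "runs n (A @ [?F, ?F]) w" using A k by (auto simp: runs_append)
  have c1: "reduces n Bs (A @ [?F, ?T] @ C) \<longleftrightarrow> reduces n Bs (A @ C)" if "runs w C n" for C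
    using reduces_cancel(1)[OF A k that, of Bs True] by simp
  have c2: "reduces n Bs (A @ [?F] @ [?F, ?T] @ C) \<longleftrightarrow> reduces n Bs (A @ [?F] @ C)"
    if "runs w C n" for C
    using reduces_cancel(1)[OF AF k that, of Bs True] by simp
  define w0 where "w0 = w - 2"
  then have w0: "w = w0 + 2" using k by simp
  have TB: "runs w ([?T] @ B) n" and TTB: "runs w ([?T, ?T] @ B) n" using k B by (simp_all add: w0)
  have U1: "reduces n Bs (A @ [?F] @ [(Cap, k), (Cup, k)] @ B)"
    using reduces_kink_cap[of n A w0 k "(Cup, k) # B" Bs False] A k B U by (simp add: w0)
  have U2: "reduces n Bs (A @ [?F, ?F] @ [(Cap, k), (Cup, k)] @ B)"
    using reduces_kink_cap[of n "A @ [?F]" w0 k "(Cup, k) # B" Bs False] AF k B U1 by (simp add: w0)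
  show ?thesis
  proof (cases s)
    case True
    have "reduces n Bs ((A @ [?F]) @ twist 0 k @ B) \<longleftrightarrow> reduces n Bs ((A @ [?F]) @ twist 3 k @ B)"
    proof (rule reduces_twist[OF AF k B])
      show "reduces n Bs ((A @ [?F]) @ twist_inf k @ B)" using U1 by (simp add: twist_inf_def)
      show "reduces n Bs ((A @ [?F]) @ twist 1 k @ B)" using c1[OF B] 0 by (simp add: twist_def)
      show "reduces n Bs ((A @ [?F]) @ twist 2 k @ B)"
        using c1[OF TB] 1 True by (simp add: twist_def numeral_2_eq_2)
    qed
    then show ?thesis using True c1[OF TTB] by (simp add: twist_def numeral_3_eq_3)
  next
    case False
    have "reduces n Bs ((A @ [?F, ?F]) @ twist 0 k @ B) \<longleftrightarrow>
        reduces n Bs ((A @ [?F, ?F]) @ twist 3 k @ B)"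
    proof (rule reduces_twist[OF AFF k B])
      show "reduces n Bs ((A @ [?F, ?F]) @ twist_inf k @ B)" using U2 by (simp add: twist_inf_def)
      show "reduces n Bs ((A @ [?F, ?F]) @ twist 1 k @ B)"
        using c2[OF B] 1 False by (simp add: twist_def)
      show "reduces n Bs ((A @ [?F, ?F]) @ twist 2 k @ B)"
        using c2[OF TB] c1[OF B] 0 by (simp add: twist_def numeral_2_eq_2)
    qed
    then show ?thesis using False c2[OF TTB] c1[OF TB] by (simp add: twist_def numeral_3_eq_3)
  qed
qed

section \<open>Words in the generators\<close>

text \<open>These are the generators \<open>S_i\<close>, their inverses and \<open>U_i\<close>. A
  hook counts as one block, so that the width is three at every block boundary.\<close>

definition blocks :: "diagram set" where
  "blocks = {[(Cross s, i)] | s i. i \<le> 1} \<union> {[(Cap, i), (Cup, i)] | i. i \<le> 1}"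

definition genword :: "diagram \<Rightarrow> bool" where
  "genword d \<longleftrightarrow> (\<exists>bs. set bs \<subseteq> blocks \<and> d = concat bs)"

lemma genword_Nil [simp]: "genword []"
  unfolding genword_def by (intro exI[of _ "[]"]) simp

lemma genword_block: "b \<in> blocks \<Longrightarrow> genword b"
  unfolding genword_def by (intro exI[of _ "[b]"]) simp

lemma genword_append [simp]: "genword A \<Longrightarrow> genword B \<Longrightarrow> genword (A @ B)"
  unfolding genword_def by (metis Un_least concat_append set_append)

lemma genword_Cross [simp]: "i \<le> 1 \<Longrightarrow> genword d \<Longrightarrow> genword ((Cross s, i) # d)"
  using genword_append[of "[(Cross s, i)]" d] genword_block[of "[(Cross s, i)]"]
  by (auto simp: blocks_def)

lemma genword_hook [simp]: "i \<le> 1 \<Longrightarrow> genword d \<Longrightarrow> genword ((Cap, i) # (Cup, i) # d)"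
  using genword_append[of "[(Cap, i), (Cup, i)]" d] genword_block[of "[(Cap, i), (Cup, i)]"]
  by (auto simp: blocks_def)

lemma runs_block: "b \<in> blocks \<Longrightarrow> runs 3 b 3"
  by (auto simp: blocks_def)

lemma runs_concat: "set bs \<subseteq> blocks \<Longrightarrow> runs 3 (concat bs) 3"
  by (induction bs) (auto intro: runs_block runs_appendI)

lemma genword_runs: "genword d \<Longrightarrow> runs 3 d 3"
  by (auto simp: genword_def runs_concat)

definition basic :: "diagram set" where "basic = basic_inv \<union> basic_noninv"

abbreviation ok :: "diagram \<Rightarrow> bool" where "ok \<equiv> reduces 3 basic"

lemma move_sym_ok:
  assumes "move u v \<or> move v u" "runs 3 A w" "runs w u w'" "runs w v w'" "runs w' B 3"
  shows "ok (A @ u @ B) \<longleftrightarrow> ok (A @ v @ B)"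
  using assms reduces_move[of u v 3 A w w' B basic] reduces_move[of v u 3 A w w' B basic] by blast

text \<open>By \<open>slide_cap\<close>, a crossing of the lower two strands followed by \<open>(Cap, 0)\<close> is also among the closers,
  up to isotopy; dually for the openers.\<close>

definition closers :: "diagram set" where
  "closers = {[(Cap, 0)], [(Cap, 1)]} \<union> {[(Cross s, 0), (Cap, 1)] | s. True}"

definition openers :: "diagram set" where
  "openers = {[(Cup, 0)], [(Cup, 1)]} \<union> {[(Cup, 1), (Cross s, 0)] | s. True}"

section \<open>Words that pass through a single strand\<close>

lemma slide_closer:
  assumes "runs 3 A 3" "runs 1 y 3"
  shows "ok (A @ [(Cross s, 1), (Cap, 0)] @ y) \<longleftrightarrow> ok (A @ [(Cross (\<not> s), 0), (Cap, 1)] @ y)"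
  by (rule move_sym_ok[OF _ assms(1) _ _ assms(2)]) (use slide_cap[of "\<not> s" 0] in auto)

lemma slide_opener:
  assumes "runs 3 B 3" "runs 3 x 1"
  shows "ok (x @ [(Cup, 0), (Cross s, 1)] @ B) \<longleftrightarrow> ok (x @ [(Cup, 1), (Cross (\<not> s), 0)] @ B)"
  by (rule move_sym_ok[OF _ assms(2) _ _ assms(1)]) (use slide_cup[of 0 "\<not> s"] in auto)

lemma zigzag_ok:
  assumes "runs 3 A 1" "runs 1 B 3"
  shows "ok (A @ [(Cup, 0), (Cap, 1)] @ B) \<longleftrightarrow> ok (A @ B)"
    and "ok (A @ [(Cup, 1), (Cap, 0)] @ B) \<longleftrightarrow> ok (A @ B)"
  using reduces_move[OF zigzag1[of 0] assms(1) _ _ assms(2)]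
    reduces_move[OF zigzag2[of 0] assms(1) _ _ assms(2)] by auto

text \<open>A cup followed by a closer is a tangle on one strand: a straight strand with a circle, a
  zigzag, or one of these with a kink. In each case it is a multiple of the straight strand.\<close>

lemma circle_closer:
  assumes A: "runs 3 A 1" and B: "runs 1 y 3" and "i \<le> 1" "g \<in> closers" "ok (A @ y)"
  shows "ok (A @ [(Cup, i)] @ g @ y)"
proof -
  have i: "i = 0 \<or> i = 1" using \<open>i \<le> 1\<close> by auto
  from \<open>g \<in> closers\<close> consider "g = [(Cap, 0)]" | "g = [(Cap, 1)]" | s where "g = [(Cross s, 0), (Cap, 1)]"
    by (auto simp: closers_def)
  then show ?thesis
  proof cases
    case 1
    then show ?thesis using i reduces_circle[OF A _ B, of 0 basic] zigzag_ok[OF A B] assms by auto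
  next
    case 2
    then show ?thesis using i reduces_circle[OF A _ B, of 1 basic] zigzag_ok[OF A B] assms by auto
  next
    case 3
    show ?thesis
    proof (cases "i = 0")
      case True
      then show ?thesis using 3 reduces_kink_cup[OF A, of 0 "(Cap, 1) # y" basic s]
          zigzag_ok[OF A B] assms by simp
    next
      case False
      then have i: "i = 1" using i by simp
      have "ok (A @ [(Cup, 1)] @ [(Cross (\<not> s), 1), (Cap, 0)] @ y)"
        using reduces_kink_cup[OF A, of 1 "(Cap, 0) # y" basic "\<not> s"] zigzag_ok[OF A B] assms by simp
      then show ?thesis
        using slide_closer[OF _ B, of "A @ [(Cup, 1)]" "\<not> s"] runs_appendI[OF A, of "[(Cup, 1)]" 3] 3 i
        by simp
    qed
  qed
qed

lemma circle_opener:
  assumes A: "runs 3 x 1" and B: "runs 1 B 3" and "i \<le> 1" "h \<in> openers" "ok (x @ B)"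
  shows "ok (x @ h @ [(Cap, i)] @ B)"
proof -
  have i: "i = 0 \<or> i = 1" using \<open>i \<le> 1\<close> by auto
  from \<open>h \<in> openers\<close> consider "h = [(Cup, 0)]" | "h = [(Cup, 1)]" | s where "h = [(Cup, 1), (Cross s, 0)]"
    by (auto simp: openers_def)
  then show ?thesis
  proof cases
    case 1
    then show ?thesis using i reduces_circle[OF A _ B, of 0 basic] zigzag_ok[OF A B] assms by auto
  next
    case 2
    then show ?thesis using i reduces_circle[OF A _ B, of 1 basic] zigzag_ok[OF A B] assms by auto
  next
    case 3
    have A1: "runs 3 (x @ [(Cup, 1)]) (1 + 2)" "runs 3 (x @ [(Cup, 0)]) (1 + 2)"
      using A by (auto simp: runs_append)
    show ?thesis
    proof (cases "i = 0")
      case True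
      then show ?thesis using 3 reduces_kink_cap[OF A1(1) _ B, of 0 basic s]
          zigzag_ok[OF A B] assms by simp
    next
      case False
      then have i: "i = 1" using i by simp
      have "ok (x @ [(Cup, 0), (Cross (\<not> s), 1)] @ (Cap, 1) # B)"
        using reduces_kink_cap[OF A1(2) _ B, of 1 basic "\<not> s"] zigzag_ok[OF A B] assms by simp
      then show ?thesis
        using slide_opener[OF _ A, of "(Cap, 1) # B" "\<not> s"] B 3 i by simp
    qed
  qed
qed

text \<open>Left multiplication by a block maps the span of the four closers to itself: a crossing
  next to its own cap is a kink, next to the other cap it gives a closer, a second crossing cancels
  or yields to the cubic relation, and a hook creates a tangle on one strand.\<close>

lemma closers_step:
  assumes A: "runs 3 A 3" and y: "runs 1 y 3" and ok: "\<And>g. g \<in> closers \<Longrightarrow> ok (A @ g @ y)"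
    and b: "b \<in> blocks" and g: "g \<in> closers"
  shows "ok (A @ b @ g @ y)"
proof -
  have ok0: "ok (A @ [(Cap, 0)] @ y)" and ok1: "ok (A @ [(Cap, 1)] @ y)"
    and okS: "ok (A @ [(Cross s, 0), (Cap, 1)] @ y)" for s
    using ok[of "[(Cap, 0)]"] ok[of "[(Cap, 1)]"] ok[of "[(Cross s, 0), (Cap, 1)]"]
    by (simp_all add: closers_def)
  have okS1: "ok (A @ [(Cross s, 1), (Cap, 0)] @ y)" for s
    using okS slide_closer[OF A y] by simp
  have A': "runs 3 A (1 + 2)" and Ab: "runs 3 (A @ b) 3"
    using A b by (simp_all add: numeral_3_eq_3 runs_appendI[OF A runs_block, unfolded numeral_3_eq_3])
  have y0: "runs 3 ((Cap, 0) # y) 3" and y1: "runs 3 ((Cap, 1) # y) 3" using y by auto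
  \<comment> \<open>These are the hook terms of the cubic relations used below; each straightens to
    a single cap.\<close>
  have zz: "ok (A @ [(Cap, 0), (Cup, 0), (Cap, 1)] @ y)" "ok (A @ [(Cap, 1), (Cup, 1), (Cap, 0)] @ y)"
    using zigzag_ok(1)[of "A @ [(Cap, 0)]" y] zigzag_ok(2)[of "A @ [(Cap, 1)]" y]
      runs_appendI[OF A, of "[(Cap, _)]" 1] y ok0 ok1 by simp_all
  from b consider s where "b = [(Cross s, 0)]" | s where "b = [(Cross s, 1)]"
    | i where "b = [(Cap, i), (Cup, i)]" "i \<le> 1"
    by (auto simp: blocks_def le_Suc_eq)
  then show ?thesis
  proof cases
    case (1 s)
    from g consider "g = [(Cap, 0)]" | "g = [(Cap, 1)]" | "g = [(Cross s, 0), (Cap, 1)]"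
      | "g = [(Cross (\<not> s), 0), (Cap, 1)]"
      by (cases s) (auto simp: closers_def)
    then show ?thesis
    proof cases
      case 3
      have "ok (A @ [(Cross s, 0), (Cross s, 0)] @ (Cap, 1) # y)"
        using reduces_cubic[OF A _ y1, of 0 basic s] zz ok1 okS by simp
      then show ?thesis using 1 3 by simp
    qed (use 1 reduces_kink_cap[OF A' _ y, of 0 basic s] okS ok0 ok1
        reduces_cancel(2)[OF A _ y1, of 0 basic s] in simp_all)
  next
    \<comment> \<open>By \<open>slide_closer\<close> a closer with a crossing can be written with
      \<open>S_2\<close> and \<open>(Cap, 0)\<close>, which makes this case symmetric to the
      first.\<close>
    case (2 s)
    from g consider "g = [(Cap, 0)]" | "g = [(Cap, 1)]" | "g = [(Cross s, 0), (Cap, 1)]"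
      | "g = [(Cross (\<not> s), 0), (Cap, 1)]"
      by (cases s) (auto simp: closers_def)
    then show ?thesis
    proof cases
      case 1
      then show ?thesis using 2 okS1 by simp
    next
      case c2: 2
      then show ?thesis using 2 reduces_kink_cap[OF A' _ y, of 1 basic s] ok1 by simp
    next
      case 3
      have "ok (A @ [(Cross s, 1), (Cross (\<not> s), 1)] @ (Cap, 0) # y)"
        using reduces_cancel(2)[OF A _ y0, of 1 basic s] ok0 by simp
      then show ?thesis using 2 3 slide_closer[OF Ab y, of "\<not> s"] by simp
    next
      case 4
      have "ok (A @ [(Cross s, 1), (Cross s, 1)] @ (Cap, 0) # y)"
        using reduces_cubic[OF A _ y0, of 1 basic s] zz ok0 okS1 by simp
      then show ?thesis using 2 4 slide_closer[OF Ab y, of s] by simp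
    qed
  next
    case (3 i)
    have "runs 3 (A @ [(Cap, i)]) 1" using A 3 by (auto simp: runs_append)
    moreover have "ok ((A @ [(Cap, i)]) @ y)" using ok0 ok1 3 by (auto simp: le_Suc_eq)
    ultimately show ?thesis using circle_closer[of "A @ [(Cap, i)]" y i g] y g 3 by simp
  qed
qed

text \<open>Mirror image of \<open>closers_step\<close>, for right multiplication.\<close>

lemma openers_step:
  assumes B: "runs 3 B 3" and x: "runs 3 x 1" and ok: "\<And>h. h \<in> openers \<Longrightarrow> ok (x @ h @ B)"
    and b: "b \<in> blocks" and h: "h \<in> openers"
  shows "ok (x @ h @ b @ B)"
proof -
  have ok0: "ok (x @ [(Cup, 0)] @ B)" and ok1: "ok (x @ [(Cup, 1)] @ B)"
    and okS: "ok (x @ [(Cup, 1), (Cross s, 0)] @ B)" for s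
    using ok[of "[(Cup, 0)]"] ok[of "[(Cup, 1)]"] ok[of "[(Cup, 1), (Cross s, 0)]"]
    by (simp_all add: openers_def)
  have okS1: "ok (x @ [(Cup, 0), (Cross s, 1)] @ B)" for s
    using okS slide_opener[OF B x] by simp
  have B': "runs (1 + 2) B 3" and bB: "runs 3 (b @ B) 3"
    using B b by (simp_all add: numeral_3_eq_3 runs_appendI[OF runs_block B, unfolded numeral_3_eq_3])
  have x0: "runs 3 (x @ [(Cup, 0)]) 3" and x1: "runs 3 (x @ [(Cup, 1)]) 3"
    using x by (auto simp: runs_append)
  have zz: "ok (x @ [(Cup, 0), (Cap, 1), (Cup, 1)] @ B)" "ok (x @ [(Cup, 1), (Cap, 0), (Cup, 0)] @ B)"
    using zigzag_ok(1)[of x "(Cup, 1) # B"] zigzag_ok(2)[of x "(Cup, 0) # B"] x B' ok0 ok1 by simp_all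
  from b consider s where "b = [(Cross s, 0)]" | s where "b = [(Cross s, 1)]"
    | i where "b = [(Cap, i), (Cup, i)]" "i \<le> 1"
    by (auto simp: blocks_def le_Suc_eq)
  then show ?thesis
  proof cases
    case (1 s)
    from h consider "h = [(Cup, 0)]" | "h = [(Cup, 1)]" | "h = [(Cup, 1), (Cross s, 0)]"
      | "h = [(Cup, 1), (Cross (\<not> s), 0)]"
      by (cases s) (auto simp: openers_def)
    then show ?thesis
    proof cases
      case 3
      have "ok ((x @ [(Cup, 1)]) @ [(Cross s, 0), (Cross s, 0)] @ B)"
        using reduces_cubic[OF x1 _ B, of 0 basic s] zz ok1 okS by simp
      then show ?thesis using 1 3 by simp
    qed (use 1 reduces_kink_cup[OF x _ B', of 0 basic s] okS ok0 ok1
        reduces_cancel(1)[OF x1 _ B, of 0 basic s] in simp_all)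
  next
    case (2 s)
    from h consider "h = [(Cup, 0)]" | "h = [(Cup, 1)]" | "h = [(Cup, 1), (Cross s, 0)]"
      | "h = [(Cup, 1), (Cross (\<not> s), 0)]"
      by (cases s) (auto simp: openers_def)
    then show ?thesis
    proof cases
      case 1
      then show ?thesis using 2 okS1 by simp
    next
      case c2: 2
      then show ?thesis using 2 reduces_kink_cup[OF x _ B', of 1 basic s] ok1 by simp
    next
      case 3
      have "ok ((x @ [(Cup, 0)]) @ [(Cross (\<not> s), 1), (Cross s, 1)] @ B)"
        using reduces_cancel(1)[OF x0 _ B, of 1 basic s] ok0 by simp
      then show ?thesis using 2 3 slide_opener[OF bB x, of "\<not> s"] by simp
    next
      case 4
      have "ok ((x @ [(Cup, 0)]) @ [(Cross s, 1), (Cross s, 1)] @ B)"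
        using reduces_cubic[OF x0 _ B, of 1 basic s] zz ok0 okS1 by simp
      then show ?thesis using 2 4 slide_opener[OF bB x, of s] by simp
    qed
  next
    case (3 i)
    have "ok (x @ (Cup, i) # B)" using ok0 ok1 3 by (auto simp: le_Suc_eq)
    then show ?thesis using circle_opener[of x "(Cup, i) # B" i h] x B' h 3 by simp
  qed
qed

lemma closer_opener_ok:
  assumes g: "g \<in> closers" and h: "h \<in> openers"
  shows "ok (g @ h)"
proof -
  have basis: "ok d" if "d \<in> basic_noninv" for d
    using that by (intro reduces_basis) (auto simp: basic_def)
  note b = basic_noninv_def U_def S_def twist_inf_def
  have UU: "ok [(Cap, 0), (Cup, 0)]" "ok [(Cap, 1), (Cup, 1)]"
    by (auto intro!: basis simp: b)
  have 01: "ok [(Cap, 0), (Cup, 1)]" "ok [(Cap, 1), (Cup, 0)]"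
  proof -
    \<comment> \<open>\<open>U_1 U_2\<close> and \<open>U_2 U_1\<close> contain a zigzag, and
      straightening it gives the two products with unequal positions.\<close>
    have "ok [(Cap, 0), (Cup, 0), (Cap, 1), (Cup, 1)]" "ok [(Cap, 1), (Cup, 1), (Cap, 0), (Cup, 0)]"
      by (auto intro!: basis simp: b)
    then show "ok [(Cap, 0), (Cup, 1)]" "ok [(Cap, 1), (Cup, 0)]"
      using zigzag_ok(1)[of "[(Cap, 0)]" "[(Cup, 1)]"] zigzag_ok(2)[of "[(Cap, 1)]" "[(Cup, 0)]"]
      by simp_all
  qed
  have c: "ok [(Cross s, 0), (Cap, 1), (Cup, 1)]" "ok [(Cap, 1), (Cup, 1), (Cross s, 0)]"
    "ok [(Cross s, 0), (Cap, 1), (Cup, 1), (Cross s', 0)]"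
    "ok [(Cross s, 1), (Cap, 0), (Cup, 0)]" "ok [(Cap, 0), (Cup, 0), (Cross s, 1)]" for s s'
    by (auto intro!: basis simp: b)
  \<comment> \<open>Sliding the crossing turns these into \<open>S_2 U_1\<close> and
    \<open>U_1 S_2\<close>, with the sign of the crossing reversed.\<close>
  have "ok [(Cross s, 0), (Cap, 1), (Cup, 0)]" "ok [(Cap, 0), (Cup, 1), (Cross s, 0)]" for s
    using slide_closer[of "[]" "[(Cup, 0)]" "\<not> s"] slide_opener[of "[]" "[(Cap, 0)]" "\<not> s"]
      c(4,5)[of "\<not> s"] by simp_all
  then show ?thesis using g h UU 01 c by (auto simp: closers_def openers_def)
qed

text \<open>The word is cut at the single strand between cap and cup. Starting there, the blocks of
  \<open>A\<close> are absorbed into the closer and those of \<open>B\<close> into the opener.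
  Unequal \<open>i\<close> and \<open>j\<close> are allowed because the two sides are
  independent.\<close>

lemma hook_word_ok:
  assumes A: "genword A" and B: "genword B" and i: "i \<le> 1" and j: "j \<le> 1"
  shows "ok (A @ [(Cap, i), (Cup, j)] @ B)"
proof -
  \<comment> \<open>All closers are treated at once, since absorbing one block gives a combination
    of several of them; the last block of \<open>as\<close> is the one next to the closer.\<close>
  have 1: "ok (concat as @ g @ h)" if "set as \<subseteq> blocks" "g \<in> closers" "h \<in> openers" for as g h
    using that
  proof (induction as arbitrary: g rule: rev_induct)
    case Nil
    then show ?case using closer_opener_ok by simp
  next
    case (snoc b as)
    have "runs 1 h 3" using snoc.prems(3) by (auto simp: openers_def)
    then show ?case using closers_step[of "concat as" h b g] snoc by (simp add: runs_concat)
  qed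
  obtain as bs where ab: "A = concat as" "B = concat bs" "set as \<subseteq> blocks" "set bs \<subseteq> blocks"
    using A B by (auto simp: genword_def)
  have x: "runs 3 (A @ [(Cap, i)]) 1" using genword_runs[OF A] i by (auto simp: runs_append)
  have "ok ((A @ [(Cap, i)]) @ h @ concat bs)" if "h \<in> openers" for h
    using ab(4) that
  proof (induction bs arbitrary: h)
    case Nil
    have "[(Cap, i)] \<in> closers" using i by (auto simp: closers_def le_Suc_eq)
    with 1[OF ab(3) this Nil(2)] ab show ?case by simp
  next
    case (Cons b bs)
    then show ?case using openers_step[OF runs_concat x, of bs b h] by simp
  qed
  moreover have "[(Cup, j)] \<in> openers" using j by (auto simp: openers_def le_Suc_eq)
  ultimately show ?thesis using ab by fastforce
qed

section \<open>Placing diagrams into a larger diagram\<close>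

definition shift :: "nat \<Rightarrow> diagram \<Rightarrow> diagram" where
  "shift k d = map (\<lambda>(f, i). (f, i + k)) d"

lemma shift_simps [simp]:
  "shift k [] = []" "shift k ((f, i) # d) = (f, i + k) # shift k d"
  "shift k (d @ d') = shift k d @ shift k d'"
  by (simp_all add: shift_def)

lemma shift_0 [simp]: "shift 0 d = d"
  by (induction d) auto

lemma shift_twist: "shift k (twist m i) = twist m (i + k)" "shift k (twist_inf i) = twist_inf (i + k)"
  by (simp_all add: shift_def twist_def twist_inf_def)

lemma runs_shift: "runs m d n \<Longrightarrow> runs (k + m + l) (shift k d) (k + n + l)"
proof (induction rule: runs.induct)
  case (runs_Cons i f m d n)
  then have "k + m + l - ins f + outs f = k + (m - ins f + outs f) + l" by simp
  with runs_Cons show ?case by simp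
qed simp

lemma move_shift: "move u v \<Longrightarrow> move (shift k u) (shift k v)"
proof (induction rule: move.induct)
  case (exchange f i g j)
  then show ?case using move.exchange[of f "i + k" g j] by (simp add: ac_simps)
qed (auto intro: move.intros(2-)[simplified])

text \<open>One form for multiplication on either side (\<open>k = 0\<close>) and for rotation
  (\<open>k = 1\<close>, the bent arcs being \<open>P\<close> and \<open>Q\<close>), so that
  compatibility with the relations is proved only once.\<close>

definition embed :: "diagram \<Rightarrow> nat \<Rightarrow> diagram \<Rightarrow> diagram \<Rightarrow> diagram" where
  "embed P k Q d = P @ shift k d @ Q"

lemma rot_embed: "rot n d = embed [(Cup, n)] 1 [(Cap, 0)] d"
  by (simp add: rot_def embed_def shift_def)

lemma embed_diagrams:
  assumes "runs n P (k + n + l)" "runs (k + n + l) Q n" "d \<in> diagrams n"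
  shows "embed P k Q d \<in> diagrams n"
  using assms runs_shift[of n d n k l] by (auto simp: embed_def diagrams_def intro!: runs_appendI)

lemma isotopic_embed:
  assumes P: "runs n P (k + n + l)" and Q: "runs (k + n + l) Q n" and "isotopic n d d'"
  shows "isotopic n (embed P k Q d) (embed P k Q d')"
  using assms(3)
proof (induction rule: isotopic.induct)
  case (isotopic_move u v A B)
  have "isotopic n ((P @ shift k A) @ shift k u @ shift k B @ Q)
      ((P @ shift k A) @ shift k v @ shift k B @ Q)"
    using embed_diagrams[OF P Q isotopic_move(2)] embed_diagrams[OF P Q isotopic_move(3)]
      move_shift[OF isotopic_move(1)]
    by (intro isotopic.isotopic_move) (simp_all add: embed_def)
  then show ?case by (simp add: embed_def)
qed (blast intro: isotopic.intros embed_diagrams[OF P Q])+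

text \<open>The linear extension of \<open>f\<close> to tangles. The choice of a representative is harmless only if \<open>f\<close>
  respects isotopy.\<close>

definition extend :: "nat \<Rightarrow> (diagram \<Rightarrow> diagram) \<Rightarrow> (tangle \<Rightarrow>\<^sub>0 R) \<Rightarrow> (tangle \<Rightarrow>\<^sub>0 R)" where
  "extend n f x = (\<Sum>T\<in>Poly_Mapping.keys x. scale (Poly_Mapping.lookup x T)
    (gen n (f (SOME d. d \<in> diagrams n \<and> tangle n d = T))))"

lemma extend_superset:
  assumes "finite F" "Poly_Mapping.keys x \<subseteq> F"
  shows "extend n f x = (\<Sum>T\<in>F. scale (Poly_Mapping.lookup x T)
    (gen n (f (SOME d. d \<in> diagrams n \<and> tangle n d = T))))"
  unfolding extend_def using assms by (intro sum.mono_neutral_left) (auto simp: in_keys_iff)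

lemma extend_add: "extend n f (x + y) = extend n f x + extend n f y"
proof -
  let ?F = "Poly_Mapping.keys x \<union> Poly_Mapping.keys y"
  show ?thesis
    using Poly_Mapping.keys_add[of x y]
    by (simp add: extend_superset[of ?F] lookup_add free.scale_left_distrib sum.distrib)
qed

lemma extend_scale: "extend n f (scale c x) = scale c (extend n f x)"
proof -
  have "Poly_Mapping.keys (scale c x) \<subseteq> Poly_Mapping.keys x" by (auto simp: in_keys_iff)
  then show ?thesis by (simp add: extend_superset[of "Poly_Mapping.keys x"] free.scale_sum_right)
qed

lemma extend_diff: "extend n f (x - y) = extend n f x - extend n f y"
  using extend_add[of n f "x - y" y] by simp

lemma extend_gen:
  assumes "\<And>d d'. isotopic n d d' \<Longrightarrow> isotopic n (f d) (f d')" "d \<in> diagrams n"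
  shows "extend n f (gen n d) = gen n (f d)"
proof -
  let ?d = "SOME d'. d' \<in> diagrams n \<and> tangle n d' = tangle n d"
  have "?d \<in> diagrams n \<and> tangle n ?d = tangle n d"
    using someI[of "\<lambda>d'. d' \<in> diagrams n \<and> tangle n d' = tangle n d" d] assms(2) by blast
  then have "isotopic n ?d d" using assms(2) tangle_eqD by blast
  then have "gen n (f ?d) = gen n (f d)"
    unfolding gen_def by (intro arg_cong2[of _ _ _ _ Poly_Mapping.single] tangle_eqI assms(1) refl)
  then show ?thesis unfolding extend_def gen_def[of n d] by simp
qed

text \<open>The small ball of a relation survives the placement: only its surroundings grow, by
  \<open>P\<close>, \<open>Q\<close> and the strands passing by. A relator therefore goes to a
  relator of the same kind.\<close>

lemma extend_embed_relators:
  assumes P: "runs n P (k + n + l)" and Q: "runs (k + n + l) Q n" and x: "x \<in> relators n"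
  shows "extend n (embed P k Q) x \<in> relators n"
proof -
  let ?f = "embed P k Q"
  have g: "extend n ?f (gen n (A @ u @ B)) = gen n ((P @ shift k A) @ shift k u @ shift k B @ Q)"
    if "runs n A w" "runs w u w'" "runs w' B n" for A u B w w'
    using that by (subst extend_gen[of n ?f, OF isotopic_embed[OF P Q]])
      (auto simp: diagrams_def embed_def intro!: runs_appendI)
  have A: "runs n (P @ shift k A) (k + w + l)" if "runs n A w" for A w
    using P runs_shift[OF that] by (auto intro: runs_appendI)
  have B: "runs (k + w + l) (shift k B @ Q) n" if "runs w B n" for B w
    using Q runs_shift[OF that] by (auto intro: runs_appendI)
  have tw: "runs w (twist m i) w" if "i + 2 \<le> w" for i m w
  proof -
    have "Suc (Suc (w - 2)) = w" using that by arith
    then show ?thesis using that by (induction m) (simp_all add: twist_def)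
  qed
  show ?thesis using x
  proof cases
    case (skein A w i B)
    have "runs w (twist_inf i) w" using skein by (auto simp: twist_inf_def)
    then show ?thesis
      using relators.skein[OF A[OF skein(2)] _ B[OF skein(4)], of "i + k"] skein(3)
      unfolding skein(1) extend_add extend_scale
      by (simp add: g[OF skein(2) tw[OF skein(3)] skein(4)] g[OF skein(2) _ skein(4)] shift_twist)
  next
    case (framing A w i B)
    have r: "runs w [(Cup, i + 1), (Cross True, i), (Cap, i + 1)] w" using framing by auto
    have "extend n ?f (gen n (A @ B)) = gen n ((P @ shift k A) @ shift k B @ Q)"
      using g[OF framing(2) _ framing(4), of "[]"] by simp
    then show ?thesis
      using relators.framing[OF A[OF framing(2)] _ B[OF framing(4)], of "i + k"] framing(3)
      unfolding framing(1) extend_diff extend_scale g[OF framing(2) r framing(4)]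
      by simp
  next
    case (circle A w i B)
    have r: "runs w [(Cup, i), (Cap, i)] w" using circle by auto
    have "extend n ?f (gen n (A @ B)) = gen n ((P @ shift k A) @ shift k B @ Q)"
      using g[OF circle(2) _ circle(4), of "[]"] by simp
    then show ?thesis
      using relators.circle[OF A[OF circle(2)] _ B[OF circle(4)], of "i + k"] circle(3)
      unfolding circle(1) extend_diff extend_scale g[OF circle(2) r circle(4)]
      by simp
  qed
qed

text \<open>A linear map that preserves relators descends to the skein module, where it is
  controlled by its values on a spanning set.\<close>

lemma reduces_embed:
  assumes P: "runs n P (k + n + l)" and Q: "runs (k + n + l) Q n"
    and Bs: "\<And>b. b \<in> Bs \<Longrightarrow> b \<in> diagrams n" "\<And>b. b \<in> Bs \<Longrightarrow> reduces n Bs' (embed P k Q b)"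
    and d: "d \<in> diagrams n" "reduces n Bs d"
  shows "reduces n Bs' (embed P k Q d)"
proof -
  let ?\<Phi> = "extend n (embed P k Q)" and ?V = "free.span (relators n \<union> gen n ` Bs')"
  have gen: "?\<Phi> (gen n d) = gen n (embed P k Q d)" if "d \<in> diagrams n" for d
    using isotopic_embed[OF P Q] that by (rule extend_gen)
  have "?\<Phi> 0 = 0" by (simp add: extend_def)
  then have "free.subspace {x. ?\<Phi> x \<in> ?V}"
    by (auto intro!: free.subspaceI simp: extend_add extend_scale
        free.span_zero free.span_add free.span_scale)
  moreover have "relators n \<union> gen n ` Bs \<subseteq> {x. ?\<Phi> x \<in> ?V}"
  proof (intro Un_least subsetI CollectI)
    fix x assume "x \<in> relators n"
    then show "?\<Phi> x \<in> ?V" by (intro relator_span extend_embed_relators[OF P Q])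
  next
    fix x assume "x \<in> gen n ` Bs"
    then show "?\<Phi> x \<in> ?V" using gen Bs unfolding reduces_def by force
  qed
  ultimately have "free.span (relators n \<union> gen n ` Bs) \<subseteq> {x. ?\<Phi> x \<in> ?V}"
    by (rule free.span_minimal[rotated])
  then show ?thesis using d gen unfolding reduces_def by auto
qed

lemma basic_runs: "b \<in> basic \<Longrightarrow> b \<in> diagrams 3"
  using basic_diagrams by (auto simp: basic_def)

lemma ok_left:
  assumes "runs 3 u 3" "runs 3 d 3" "ok d" "\<And>b. b \<in> basic \<Longrightarrow> ok (u @ b)"
  shows "ok (u @ d)"
proof -
  have "ok (embed u 0 [] d)"
  proof (rule reduces_embed[of 3 u 0 0 "[]" basic])
    show "ok (embed u 0 [] b)" if "b \<in> basic" for b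
      using assms(4)[OF that] by (simp add: embed_def)
  qed (use assms(1-3) basic_runs in \<open>simp_all add: diagrams_def\<close>)
  then show ?thesis by (simp add: embed_def)
qed

lemma ok_right:
  assumes "runs 3 u 3" "runs 3 d 3" "ok d" "\<And>b. b \<in> basic \<Longrightarrow> ok (b @ u)"
  shows "ok (d @ u)"
proof -
  have "ok (embed [] 0 u d)"
  proof (rule reduces_embed[of 3 "[]" 0 0 u basic])
    show "ok (embed [] 0 u b)" if "b \<in> basic" for b
      using assms(4)[OF that] by (simp add: embed_def)
  qed (use assms(1-3) basic_runs in \<open>simp_all add: diagrams_def\<close>)
  then show ?thesis by (simp add: embed_def)
qed

lemma ok_rot:
  assumes "runs 3 d 3" "ok d" "\<And>b. b \<in> basic \<Longrightarrow> ok (rot 3 b)"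
  shows "ok (rot 3 d)"
  unfolding rot_embed
proof (rule reduces_embed[of 3 "[(Cup, 3)]" 1 1 "[(Cap, 0)]" basic])
  show "ok (embed [(Cup, 3)] 1 [(Cap, 0)] b)" if "b \<in> basic" for b
    using assms(3)[OF that] by (simp add: rot_embed)
qed (use assms(1,2) basic_runs in \<open>simp_all add: diagrams_def\<close>)

section \<open>Invertible words\<close>

abbreviation x1 :: slice where "x1 \<equiv> (Cross True, 0)"
abbreviation X1 :: slice where "X1 \<equiv> (Cross False, 0)"
abbreviation x2 :: slice where "x2 \<equiv> (Cross True, 1)"
abbreviation X2 :: slice where "X2 \<equiv> (Cross False, 1)"

definition braid :: "diagram \<Rightarrow> bool" where
  "braid d \<longleftrightarrow> set d \<subseteq> {x1, X1, x2, X2}"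

text \<open>Unreduced words in one generator and its inverse, not only pure powers; cancellation is
  left to \<open>ok_powers\<close>.\<close>

definition powers :: "nat \<Rightarrow> diagram set" where
  "powers i = {d. set d \<subseteq> {(Cross True, i), (Cross False, i)}}"

lemma braid_simps [simp]:
  "braid []" "braid ((Cross s, i) # d) \<longleftrightarrow> i \<le> 1 \<and> braid d" "braid (d @ d') \<longleftrightarrow> braid d \<and> braid d'"
  by (auto simp: braid_def)

lemma powers_simps [simp]:
  "[] \<in> powers i" "(Cross s, j) # d \<in> powers i \<longleftrightarrow> j = i \<and> d \<in> powers i"
  by (auto simp: powers_def)

lemma powers_braid: "d \<in> powers i \<Longrightarrow> i \<le> 1 \<Longrightarrow> braid d"
  by (auto simp: powers_def braid_def le_Suc_eq)

lemma braid_genword: "braid d \<Longrightarrow> genword d"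
proof (induction d)
  case (Cons s d)
  then have "s \<in> {x1, X1, x2, X2}" "genword d" by (auto simp: braid_def)
  then show ?case by auto
qed simp

lemma braid_runs: "braid d \<Longrightarrow> runs 3 d 3"
  by (intro genword_runs braid_genword)

lemma ok_cancel:
  assumes "braid A" "i \<le> 1" "braid B"
  shows "ok (A @ [(Cross s, i), (Cross (\<not> s), i)] @ B) \<longleftrightarrow> ok (A @ B)"
  using reduces_cancel(2)[of 3 A 3 i B] assms by (simp add: braid_runs)

text \<open>The hook term of the skein relation is already reduced by \<open>hook_word_ok\<close>;
  what remains is the cubic Hecke relation.\<close>

lemma ok_cubic:
  assumes "braid A" "i \<le> 1" "braid B" "ok (A @ B)" "ok (A @ [(Cross s, i)] @ B)"
  shows "ok (A @ [(Cross s, i), (Cross s, i)] @ B) \<longleftrightarrow> ok (A @ [(Cross (\<not> s), i)] @ B)"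
  using hook_word_ok[of A B i i] assms
  by (intro reduces_cubic[of 3 A 3 i B]) (auto simp: braid_runs braid_genword)

text \<open>Modulo hooks every power of a generator is a combination of the exponents 0, 1 and -1.
  The first two letters either cancel or form a square, which is traded for shorter words.\<close>

lemma ok_powers:
  assumes A: "braid A" and i: "i \<le> 1" and B: "braid B"
    and 0: "ok (A @ B)" and 1: "ok (A @ [(Cross True, i)] @ B)" and 2: "ok (A @ [(Cross False, i)] @ B)"
    and u: "u \<in> powers i"
  shows "ok (A @ u @ B)"
  using u
proof (induction u rule: length_induct)
  case (1 u)
  have s1: "ok (A @ [(Cross s, i)] @ B)" for s using assms by (cases s) auto
  have IH: "ok (A @ v @ B)" if "length v < length u" "v \<in> powers i" for v
    using 1 that by blast
  show ?case
  proof (cases "length u \<le> 1")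
    case True
    then have "u = [] \<or> (\<exists>l. u = [l])" by (cases u) auto
    then show ?thesis using s1 0 1(2) by (auto simp: powers_def)
  next
    case False
    then obtain l l' v where u: "u = l # l' # v" by (cases u; cases "tl u") auto
    obtain s s' where l: "l = (Cross s, i)" "l' = (Cross s', i)" and v: "v \<in> powers i"
      using 1(2) u by (auto simp: powers_def)
    have vB: "braid (v @ B)" using powers_braid[OF v i] B by simp
    show ?thesis
    proof (cases "s' = s")
      case True
      have "ok (A @ [(Cross t, i)] @ v @ B)" for t
        using IH[of "(Cross t, i) # v"] v u by simp
      then show ?thesis using ok_cubic[OF A i vB, of s] IH[of v] v u l True by simp
    next
      case False
      then have "s' = (\<not> s)" by auto
      then show ?thesis using ok_cancel[OF A i vB, of s] IH[of v] v u l by simp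
    qed
  qed
qed

lemma ok_inverse:
  assumes "braid A" "i \<le> 1" "braid B"
    and "ok (A @ B)" "ok (A @ [(Cross s, i)] @ B)" "ok (A @ [(Cross s, i), (Cross s, i)] @ B)"
  shows "ok (A @ [(Cross (\<not> s), i)] @ B)"
  using ok_cubic assms by blast

lemma ok_braid:
  assumes A: "braid A" and B: "braid B"
  shows "ok (A @ [(Cross s, 0), (Cross s, 1), (Cross s, 0)] @ B) \<longleftrightarrow>
    ok (A @ [(Cross s, 1), (Cross s, 0), (Cross s, 1)] @ B)"
  using reid3[of s 0] by (intro move_sym_ok[of _ _ _ 3 3]) (auto intro: braid_runs assms)

text \<open>The braid relation in the form \<open>S_i S_j S_i^{-1} = S_j^{-1} S_i S_j\<close>, all
  signs being reversed for \<open>s\<close> false: insert a cancelling pair, apply the braid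
  relation, cancel.\<close>

lemma ok_conj:
  assumes A: "braid A" and B: "braid B" and "(i = 0 \<and> j = 1) \<or> (i = 1 \<and> j = 0)"
  shows "ok (A @ [(Cross s, i), (Cross s, j), (Cross (\<not> s), i)] @ B) \<longleftrightarrow>
    ok (A @ [(Cross (\<not> s), j), (Cross s, i), (Cross s, j)] @ B)"
proof -
  let ?S = "\<lambda>s i. (Cross s, i)"
  have ij: "i \<le> 1" "j \<le> 1" using assms(3) by auto
  have b: "ok (A' @ [?S s i, ?S s j, ?S s i] @ B') \<longleftrightarrow> ok (A' @ [?S s j, ?S s i, ?S s j] @ B')"
    if "braid A'" "braid B'" for A' B'
    using ok_braid[OF that, of s] assms(3) by auto
  have "ok (A @ [?S s i, ?S s j, ?S (\<not> s) i] @ B) \<longleftrightarrow>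
      ok (A @ [?S (\<not> s) j, ?S s j] @ [?S s i, ?S s j, ?S (\<not> s) i] @ B)"
    using ok_cancel[of A j "[?S s i, ?S s j, ?S (\<not> s) i] @ B" "\<not> s"] A B ij by simp
  also have "\<dots> \<longleftrightarrow> ok ((A @ [?S (\<not> s) j]) @ [?S s i, ?S s j, ?S s i] @ [?S (\<not> s) i] @ B)"
    using b[of "A @ [?S (\<not> s) j]" "[?S (\<not> s) i] @ B"] A B ij by simp
  also have "\<dots> \<longleftrightarrow> ok (A @ [?S (\<not> s) j, ?S s i, ?S s j] @ B)"
    using ok_cancel[of "A @ [?S (\<not> s) j, ?S s i, ?S s j]" i B s] A B ij by simp
  finally show ?thesis .
qed

lemmas conj01 = ok_conj[where i = 0 and j = 1] and conj10 = ok_conj[where i = 1 and j = 0]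

section \<open>Spanning words of the cubic Hecke algebra\<close>

lemma ok_basic_inv: "d \<in> basic_inv \<Longrightarrow> ok d"
  by (intro reduces_basis) (auto simp: basic_def)

lemma ok_basic_inv_words:
  "ok []" "ok [(Cross s, 0)]" "ok [(Cross s, 1)]"
  "ok [(Cross s, 0), (Cross s', 1)]" "ok [(Cross s, 1), (Cross s', 0)]"
  "ok [(Cross s, 0), (Cross s', 1), (Cross s'', 0)]"
  "ok [x2, X1, x2]" "ok [X2, x1, X2]" "ok [x1, X2, x1, X2]"
  by (auto intro!: ok_basic_inv simp: basic_inv_def S_def)

lemmas words = ok_basic_inv_words[simplified]

text \<open>Each syllable reduces to the exponents 0, 1 and -1, and the outer syllables merge if the
  middle one vanishes. The words left over are basic.\<close>

lemma ok_aba: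
  assumes u: "u \<in> powers 0" and m: "m \<in> powers 1" and v: "v \<in> powers 0"
  shows "ok (u @ m @ v)"
proof -
  have u': "braid u" and m': "braid m" and v': "braid v"
    using assms powers_braid by auto
  have "ok ([(Cross s, 0), (Cross s', 1)] @ v)" for s s'
    using ok_powers[of "[(Cross s, 0), (Cross s', 1)]" 0 "[]" v] v by (simp add: words)
  moreover have "ok ([(Cross s, 1)] @ v)" for s
    using ok_powers[of "[(Cross s, 1)]" 0 "[]" v] v by (simp add: words)
  moreover have "ok ([(Cross s, 0)] @ v)" for s
    using ok_powers[of "[]" 0 "[]" "[(Cross s, 0)] @ v"] v by (simp add: words)
  moreover have "ok v"
    using ok_powers[of "[]" 0 "[]" v] v by (simp add: words)
  ultimately have s2: "ok ([(Cross s, 0)] @ m @ v)" "ok (m @ v)" for s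
    using ok_powers[of "[(Cross s, 0)]" 1 v m] ok_powers[of "[]" 1 v m] v' m by simp_all
  show ?thesis using ok_powers[of "[]" 0 "m @ v" u] s2 m' v' u by simp
qed

text \<open>The exponents 0 and -1 of \<open>m\<close> give basic words; for the exponent 1,
  \<open>S_2^{-1} S_1 S_2\<close> is conjugated into \<open>S_1 S_2 S_1^{-1}\<close>. The next three
  facts are variants with other signs or in reverse order.\<close>

lemma ok_X2x1_powers: "m \<in> powers 1 \<Longrightarrow> ok ([X2, x1] @ m)"
  using ok_powers[of "[X2, x1]" 1 "[]" m] conj01[of "[]" "[]" True] by (simp add: words)

lemma ok_x2X1_powers: "m \<in> powers 1 \<Longrightarrow> ok ([x2, X1] @ m)"
  using ok_powers[of "[x2, X1]" 1 "[]" m] conj01[of "[]" "[]" False] by (simp add: words)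

lemma ok_powers_x1X2: "m \<in> powers 1 \<Longrightarrow> ok (m @ [x1, X2])"
  using ok_powers[of "[]" 1 "[x1, X2]" m] conj10[of "[]" "[]" True] by (simp add: words)

lemma ok_powers_X1x2: "m \<in> powers 1 \<Longrightarrow> ok (m @ [X1, x2])"
  using ok_powers[of "[]" 1 "[X1, x2]" m] conj10[of "[]" "[]" False] by (simp add: words)

text \<open>The exponent 1 of \<open>u\<close> is where the basic word
  \<open>(S_1 S_2^{-1})^2\<close> appears; the exponent -1 is removed by conjugation.\<close>

lemma ok_powers_X2x1X2:
  assumes "u \<in> powers 0"
  shows "ok (u @ [X2, x1, X2])"
proof -
  have "ok [X1, X2, x1, X2]"
    using conj01[of "[]" "[X2]" False] ok_x2X1_powers[of "[X2, X2]"] by simp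
  then show ?thesis using ok_powers[of "[]" 0 "[X2, x1, X2]" u] assms by (simp add: words)
qed

text \<open>The exponent -1 gives \<open>(S_1^{-1} S_2)^2\<close>, which is not basic. It is
  recovered from the exponents 0, 1 and 2 by the cubic relation; the exponent 2 becomes
  \<open>S_1 S_2^{-1} S_1 S_2^2\<close>, whose expansion involves
  \<open>(S_1 S_2^{-1})^2\<close>.\<close>

lemma ok_powers_x2X1x2:
  assumes "u \<in> powers 0"
  shows "ok (u @ [x2, X1, x2])"
proof -
  have 1: "ok [x1, x2, X1, x2]"
    using conj01[of "[]" "[x2]" True] ok_X2x1_powers[of "[x2, x2]"] by simp
  have "ok [x1, X2, x1, x2]"
    using conj01[of "[x1]" "[]" True] ok_aba[of "[x1, x1]" "[x2]" "[X1]"] by simp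
  then have "ok [x1, X2, x1, x2, x2]"
    using ok_powers[of "[x1, X2, x1]" 1 "[]" "[x2, x2]"] by (simp add: words)
  then have "ok [x1, x1, x2, X1, x2]"
    using conj01[of "[x1]" "[x2]" True] by simp
  then have "ok [X1, x2, X1, x2]"
    using ok_inverse[of "[]" 0 "[x2, X1, x2]" True] 1 by (simp add: words)
  then show ?thesis using ok_powers[of "[]" 0 "[x2, X1, x2]" u] 1 assms by (simp add: words)
qed

text \<open>Modulo the tangles that contain a hook, and the span of the words of type
  \<open>S\<^sub>1\<^sup>i S\<^sub>2\<^sup>j S\<^sub>1\<^sup>k\<close>, the element \<open>S\<^sub>1\<close> commutes with \<open>S\<^sub>2 S\<^sub>1\<^sup>-\<^sup>1 S\<^sub>2\<close>.
  This is how \<open>S\<^sub>2\<^sup>-\<^sup>1 S\<^sub>1 S\<^sub>2\<^sup>-\<^sup>1 S\<^sub>1\<close> is traded for \<open>(S\<^sub>1 S\<^sub>2\<^sup>-\<^sup>1)\<^sup>2\<close>.\<close>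

lemma ok_X2x1X2x1: "ok [X2, x1, X2, x1]"
proof -
  have "ok [x1, x2, x1, X2]"
    using conj10[of "[x1]" "[]" True] ok_aba[of "[x1, X1]" "[x2]" "[x1]"] by simp
  \<comment> \<open>Expanding \<open>S_2^2\<close> brings in the exponent -1, that is, the basic
    word \<open>(S_1 S_2^{-1})^2\<close>.\<close>
  then have "ok [x1, x2, x2, x1, X2]"
    using ok_powers[of "[x1]" 1 "[x1, X2]" "[x2, x2]"] ok_aba[of "[x1, x1]" "[X2]" "[]"]
    by (simp add: words)
  then have "ok [x1, x2, X1, x2, x1]"
    using conj10[of "[x1, x2]" "[]" True] by simp
  then have "ok [X2, x1, x2, x2, x1]"
    using conj01[of "[]" "[x2, x1]" True] by simp
  moreover have "ok [X2, x1, x2, x1]"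
    using conj01[of "[]" "[x1]" True] ok_aba[of "[x1]" "[x2]" "[X1, x1]"] by simp
  moreover have "ok [X2, x1, x1]"
    using ok_aba[of "[]" "[X2]" "[x1, x1]"] by simp
  ultimately show ?thesis using ok_inverse[of "[X2, x1]" 1 "[x1]" True] by simp
qed

lemma ok_X2x1X2_powers:
  assumes "u \<in> powers 0"
  shows "ok ([X2, x1, X2] @ u)"
proof -
  have "ok [X2, x1, X2, X1]"
    using conj10[of "[X2]" "[]" False] ok_powers_X1x2[of "[X2, X2]"] by simp
  then show ?thesis using ok_powers[of "[X2, x1, X2]" 0 "[]" u] ok_X2x1X2x1 assms by (simp add: words)
qed

text \<open>As in \<open>ok_powers_x2X1x2\<close>, the exponent -1 comes from 0, 1 and 2; here the
  expansion of \<open>S_2^2\<close> meets the word of \<open>ok_X2x1X2x1\<close>.\<close>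

lemma ok_x2X1x2_powers:
  assumes "u \<in> powers 0"
  shows "ok ([x2, X1, x2] @ u)"
proof -
  have 1: "ok [x2, X1, x2, x1]"
    using conj10[of "[x2]" "[]" True] ok_powers_x1X2[of "[x2, x2]"] by simp
  have "ok [x2, x1, X2, x1]"
    using conj10[of "[]" "[x1]" True] ok_aba[of "[X1]" "[x2]" "[x1, x1]"] by simp
  then have "ok [x2, x2, x1, X2, x1]"
    using ok_powers[of "[]" 1 "[x1, X2, x1]" "[x2, x2]"] ok_X2x1X2x1 by (simp add: words)
  then have "ok [x2, X1, x2, x1, x1]"
    using conj10[of "[x2]" "[x1]" True] by simp
  then have "ok [x2, X1, x2, X1]"
    using ok_inverse[of "[x2, X1, x2]" 0 "[]" True] 1 by (simp add: words)
  then show ?thesis using ok_powers[of "[x2, X1, x2]" 0 "[]" u] 1 assms by (simp add: words)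
qed

section \<open>Multiplication of basic tangles\<close>

lemma genword_hook_ok:
  assumes "genword d" "\<not> braid d"
  shows "ok d"
proof -
  have split: "braid (concat bs) \<or>
      (\<exists>A i B. genword A \<and> genword B \<and> i \<le> 1 \<and> concat bs = A @ [(Cap, i), (Cup, i)] @ B)"
    if "set bs \<subseteq> blocks" for bs
    using that
  proof (induction bs)
    case (Cons b bs)
    have bs: "genword (concat bs)" using Cons.prems by (auto simp: genword_def)
    consider s i where "b = [(Cross s, i)]" "i \<le> 1" | i where "b = [(Cap, i), (Cup, i)]" "i \<le> 1"
      using Cons.prems by (auto simp: blocks_def)
    then show ?case
    proof cases
      case 1
      then have "braid (concat (b # bs))" if "braid (concat bs)" using that by simp
      moreover have "concat (b # bs) = ((Cross s, i) # A) @ C" if "concat bs = A @ C" for A C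
        using that 1 by simp
      ultimately show ?thesis using Cons 1 genword_Cross[of i _ s]
        by (metis insert_subset list.simps(15))
    next
      case 2
      then have "concat (b # bs) = [] @ [(Cap, i), (Cup, i)] @ concat bs" by simp
      then show ?thesis using bs 2 genword_Nil by blast
    qed
  qed simp
  from assms split show ?thesis unfolding genword_def[of d] using hook_word_ok by metis
qed

lemma basic_noninv_genword: "b \<in> basic_noninv \<Longrightarrow> genword b \<and> \<not> braid b"
  by (auto simp: basic_noninv_def U_def S_def twist_inf_def braid_def)

lemma basic_inv_braid: "b \<in> basic_inv \<Longrightarrow> braid b"
  by (auto simp: basic_inv_def S_def)

lemma basic_cases:
  assumes "b \<in> basic"
  obtains "b \<in> basic_inv" | "genword b" "\<not> braid b"
  using assms basic_noninv_genword by (auto simp: basic_def)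

lemma basic_genword: "b \<in> basic \<Longrightarrow> genword b"
  by (erule basic_cases) (auto intro: basic_inv_braid braid_genword)

lemma ok_aba_words:
  "ok [(Cross s, 0), (Cross s', 0)]" "ok [(Cross s, 1), (Cross s', 1)]"
  "ok [(Cross s, 0), (Cross s', 0), (Cross s'', 1)]"
  "ok [(Cross s, 1), (Cross s', 0), (Cross s'', 0)]"
  "ok [(Cross s, 0), (Cross s', 1), (Cross s'', 0)]"
  "ok [(Cross s, 1), (Cross s', 1), (Cross s'', 0)]"
  "ok [(Cross s, 0), (Cross s', 0), (Cross s'', 1), (Cross s3, 0)]"
  "ok [(Cross s, 0), (Cross s', 1), (Cross s'', 0), (Cross s3, 0)]"
  using ok_aba[of "[(Cross s, 0)]" "[]" "[(Cross s', 0)]"]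
    ok_aba[of "[]" "[(Cross s, 1), (Cross s', 1)]" "[]"]
    ok_aba[of "[(Cross s, 0), (Cross s', 0)]" "[(Cross s'', 1)]" "[]"]
    ok_aba[of "[]" "[(Cross s, 1)]" "[(Cross s', 0), (Cross s'', 0)]"]
    ok_aba[of "[(Cross s, 0)]" "[(Cross s', 1)]" "[(Cross s'', 0)]"]
    ok_aba[of "[]" "[(Cross s, 1), (Cross s', 1)]" "[(Cross s'', 0)]"]
    ok_aba[of "[(Cross s, 0), (Cross s', 0)]" "[(Cross s'', 1)]" "[(Cross s3, 0)]"]
    ok_aba[of "[(Cross s, 0)]" "[(Cross s', 1)]" "[(Cross s'', 0), (Cross s3, 0)]"]
  by simp_all

lemmas aba_words = words ok_aba_words[simplified]

text \<open>On a basic braid word the result has the form \<open>S_1^i S_2^j S_1^k\<close>, or it is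
  a power of \<open>S_1\<close> in front of \<open>S_2 S_1^{-1} S_2\<close> or
  \<open>S_2^{-1} S_1 S_2^{-1}\<close>. Words with a hook stay words with a hook.\<close>

lemma ok_S1_left:
  assumes "runs 3 d 3" "ok d"
  shows "ok ([(Cross s, 0)] @ d)"
proof (rule ok_left[OF _ assms])
  fix b assume "b \<in> basic"
  then show "ok ([(Cross s, 0)] @ b)"
  proof (cases rule: basic_cases)
    case 1
    then show ?thesis
      using ok_powers_X2x1X2[of "[(Cross s, 0)]"] ok_powers_x2X1x2[of "[(Cross s, 0)]"]
        ok_powers_X2x1X2[of "[(Cross s, 0), x1]"]
      by (auto simp: basic_inv_def S_def aba_words)
  next
    case 2
    then show ?thesis using genword_hook_ok[of "(Cross s, 0) # b"] by simp
  qed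
qed simp

lemma ok_S1_right:
  assumes "runs 3 d 3" "ok d"
  shows "ok (d @ [(Cross s, 0)])"
proof (rule ok_right[OF _ assms])
  fix b assume "b \<in> basic"
  then show "ok (b @ [(Cross s, 0)])"
  proof (cases rule: basic_cases)
    case 1
    \<comment> \<open>The leading \<open>S_1\<close> is split off, which leaves the case of
      \<open>ok_X2x1X2_powers\<close>.\<close>
    have "ok [x1, X2, x1, X2, (Cross s, 0)]"
      using ok_S1_left[of "[X2, x1, X2, (Cross s, 0)]" True] ok_X2x1X2_powers[of "[(Cross s, 0)]"]
      by simp
    then show ?thesis
      using 1 ok_X2x1X2_powers[of "[(Cross s, 0)]"] ok_x2X1x2_powers[of "[(Cross s, 0)]"]
      by (auto simp: basic_inv_def S_def aba_words)
  next
    case 2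
    then show ?thesis using genword_hook_ok[of "b @ [(Cross s, 0)]"] by simp
  qed
qed simp

text \<open>Two of the eight sign patterns are basic; the braid relation or a conjugation brings the
  others to words starting and ending with \<open>S_1\<close>.\<close>

lemma ok_bab: "ok [(Cross s, 1), (Cross s', 0), (Cross s'', 1)]"
proof -
  have "ok [(Cross s, 1), (Cross s, 0), (Cross s'', 1)]"
    using ok_braid[of "[]" "[]" s] conj10[of "[]" "[]" s] by (cases "s'' = s") (auto simp: aba_words)
  moreover have "ok [(Cross s, 1), (Cross (\<not> s), 0), (Cross s'', 1)]"
    using conj01[of "[]" "[]" "\<not> s"] by (cases "s"; cases "s''") (auto simp: aba_words)
  ultimately show ?thesis by (cases "s' = s") auto
qed

text \<open>For the positive sign, conjugating the leading \<open>S_2 S_1 S_2^{-1}\<close> creates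
  an \<open>S_1^2\<close> that can be expanded. The negative sign then follows from the exponents 0,
  1 and 2 of the leading \<open>S_2\<close>.\<close>

lemma ok_S2_long: "ok [(Cross s, 1), x1, X2, x1, X2]"
proof -
  note bab = ok_bab[simplified]
  have "ok [X1, x2, X1, X2]" "ok [X1, x2, x1, X2]" "ok [X1, x2, X2]"
    using conj01[of "[X1]" "[]" False] conj10[of "[X1]" "[]" True] ok_cancel[of "[X1]" 1 "[]" True]
    by (simp_all add: aba_words)
  then have "ok [X1, x2, x1, x1, X2]"
    using ok_powers[of "[X1, x2]" 0 "[X2]" "[x1, x1]"] by simp
  then have 1: "ok [x2, x1, X2, x1, X2]"
    using conj10[of "[]" "[x1, X2]" True] by simp
  \<comment> \<open>Preparation for the exponent 2, where expanding \<open>S_1^2\<close> leaves the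
    words \<open>S_2 S_1^{-1} S_2 S_1^n S_2^{-1}\<close> with \<open>n\<close> in 0, 1, -1.\<close>
  have "ok [x2, X1, X1, x2]" "ok [x2, X1, X1, X2]"
    using ok_powers[of "[x2]" 0 "[x2]" "[X1, X1]"] ok_powers[of "[x2]" 0 "[X2]" "[X1, X1]"]
    by (simp_all add: aba_words bab)
  then have "ok [x2, X1, X1, x2, x1]" "ok [x2, X1, X1, X2, x1]"
    using ok_S1_right[of "[x2, X1, X1, x2]" True] ok_S1_right[of "[x2, X1, X1, X2]" True] by simp_all
  then have "ok [x2, X1, x2, x1, X2]" "ok [x2, X1, x2, X1, X2]" "ok [x2, X1, x2, X2]"
    using conj10[of "[x2, X1]" "[]" True] conj01[of "[x2, X1]" "[]" False]
      ok_cancel[of "[x2, X1]" 1 "[]" True] by (simp_all add: aba_words)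
  then have "ok [x2, X1, x2, x1, x1, X2]"
    using ok_powers[of "[x2, X1, x2]" 0 "[X2]" "[x1, x1]"] by simp
  then have "ok [x2, x2, x1, X2, x1, X2]"
    using conj10[of "[x2]" "[x1, X2]" True] by simp
  then have "ok [X2, x1, X2, x1, X2]"
    using ok_inverse[of "[]" 1 "[x1, X2, x1, X2]" True] 1 by (simp add: words)
  with 1 show ?thesis by (cases s) simp_all
qed

lemma ok_S2_left:
  assumes "runs 3 d 3" "ok d"
  shows "ok ([(Cross s, 1)] @ d)"
proof (rule ok_left[OF _ assms])
  fix b assume "b \<in> basic"
  then show "ok ([(Cross s, 1)] @ b)"
  proof (cases rule: basic_cases)
    case 1
    have "ok [(Cross s, 1), (Cross s', 0), (Cross s'', 1), (Cross s3, 0)]" for s' s'' s3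
      using ok_S1_right[of "[(Cross s, 1), (Cross s', 0), (Cross s'', 1)]" s3] ok_bab by simp
    then show ?thesis
      using 1 ok_powers_x1X2[of "[(Cross s, 1), X2]"] ok_powers_X1x2[of "[(Cross s, 1), x2]"]
        ok_S2_long[of s]
      by (auto simp: basic_inv_def S_def aba_words ok_bab[simplified])
  next
    case 2
    then show ?thesis using genword_hook_ok[of "(Cross s, 1) # b"] by simp
  qed
qed simp

lemma ok_block_left:
  assumes "b \<in> blocks" "runs 3 d 3" "ok d"
  shows "ok (b @ d)"
proof -
  consider s where "b = [(Cross s, 0)]" | s where "b = [(Cross s, 1)]"
    | i where "b = [(Cap, i), (Cup, i)]" "i \<le> 1"
    using assms(1) by (auto simp: blocks_def le_Suc_eq)
  then show ?thesis
  proof cases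
    case 3
    have "ok (b @ c)" if "c \<in> basic" for c
      using 3 basic_genword[OF that] genword_hook_ok[of "b @ c"] by (auto simp: braid_def)
    then show ?thesis using ok_left assms runs_block by blast
  qed (use assms ok_S1_left ok_S2_left in auto)
qed

lemma ok_genword_left:
  assumes "genword u" "runs 3 d 3" "ok d"
  shows "ok (u @ d)"
proof -
  have "ok (concat bs @ d)" if "set bs \<subseteq> blocks" for bs
    using that assms
  proof (induction bs)
    case (Cons b bs)
    then show ?case
      using ok_block_left[of b "concat bs @ d"] by (auto intro: runs_appendI runs_concat)
  qed simp
  with assms show ?thesis by (auto simp: genword_def)
qed

lemma ok_genword: "genword u \<Longrightarrow> ok u"
  using ok_genword_left[of u "[]"] by (simp add: words)

text \<open>By linearity the left factor may be replaced by basic words. These are words in the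
  generators, so left multiplication is all that is needed.\<close>

lemma ok_append:
  assumes "runs 3 d 3" "ok d" "runs 3 d' 3" "ok d'"
  shows "ok (d @ d')"
proof (rule ok_right[OF assms(3,1,2)])
  fix b assume "b \<in> basic"
  then show "ok (b @ d')" by (intro ok_genword_left basic_genword assms(3,4))
qed

section \<open>Rotation\<close>

lemma rot_runs: "runs 3 d 3 \<Longrightarrow> runs 3 (rot 3 d) 3"
  using embed_diagrams[of 3 "[(Cup, 3)]" 1 1 "[(Cap, 0)]" d] by (simp add: rot_embed diagrams_def)

text \<open>Here and in the next three rules positions are tied by equations, so that the rules
  match concrete numerals.\<close>

lemma ok_zigzag2:
  assumes "runs 3 A w" "runs w B 3" "i < w" "j = i + 1"
  shows "ok (A @ [(Cup, j), (Cap, i)] @ B) \<longleftrightarrow> ok (A @ B)"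
  using reduces_move[OF zigzag2[of i] assms(1) _ _ assms(2)] assms(3,4) by auto

lemma ok_exchange:
  assumes "runs 3 A w" "runs w' B 3" "j = i + outs f + k" "j' = i + ins f + k"
    and "runs w [(f, i), (g, j)] w'" "runs w [(g, j'), (f, i)] w'"
  shows "ok (A @ [(f, i), (g, j)] @ B) \<longleftrightarrow> ok (A @ [(g, j'), (f, i)] @ B)"
  using assms(5,6) unfolding assms(3,4)
  by (intro move_sym_ok[OF disjI1[OF move.exchange] assms(1) _ _ assms(2)])

lemma ok_slide_cap:
  assumes "runs 3 A (w + 2)" "runs w B 3" "i < w" "j = i + 1"
  shows "ok (A @ [(Cross s, i), (Cap, j)] @ B) \<longleftrightarrow> ok (A @ [(Cross (\<not> s), j), (Cap, i)] @ B)"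
  using slide_cap[of s i] assms by (intro move_sym_ok[of _ _ A "w + 2" w B]) auto

lemma ok_slide_cup:
  assumes "runs 3 A w" "runs (w + 2) B 3" "i < w" "j = i + 1"
  shows "ok (A @ [(Cup, j), (Cross s, i)] @ B) \<longleftrightarrow> ok (A @ [(Cup, i), (Cross (\<not> s), j)] @ B)"
  using slide_cup[of i s] assms by (intro move_sym_ok[of _ _ A w "w + 2" B]) auto

text \<open>The bent arc moves a generator of the upper two strands one position down, where it is
  disjoint from the cup at the bottom. It can thus leave the rotated diagram on the left.\<close>

lemma ok_rot_left:
  assumes "runs 3 d 3" "ok (rot 3 d)" "b = [(Cross s, 0)] \<or> b = [(Cap, 0), (Cup, 0)]"
  shows "ok (rot 3 (b @ d))"
proof -
  let ?B = "shift 1 d @ [(Cap, 0)]"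
  have B: "runs 5 ?B 3" using runs_shift[OF assms(1), of 1 1] by (auto intro!: runs_appendI)
  have B': "runs 3 ([(Cup, 1)] @ ?B) 3" using B by simp
  have ok: "ok (c @ rot 3 d)" if "c \<in> blocks" for c
    using that rot_runs[OF assms(1)] assms(2) by (rule ok_block_left)
  from assms(3) show ?thesis
  proof
    assume b: "b = [(Cross s, 0)]"
    have "ok ([(Cross s, 1), (Cup, 3)] @ ?B)"
      using ok[of "[(Cross s, 1)]"] by (auto simp: rot_embed embed_def blocks_def)
    then have "ok ([(Cup, 3), (Cross s, 1)] @ ?B)"
      using ok_exchange[of "[]" 3 5 ?B 3 1 "Cross s" 0 3 Cup, OF _ B] by simp
    then show ?thesis by (simp add: b rot_embed embed_def)
  next
    assume b: "b = [(Cap, 0), (Cup, 0)]"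
    have "ok ([(Cap, 1)] @ [(Cup, 1), (Cup, 3)] @ ?B)"
      using ok[of "[(Cap, 1), (Cup, 1)]"] by (auto simp: rot_embed embed_def blocks_def)
    then have "ok ([] @ [(Cap, 1), (Cup, 1)] @ [(Cup, 1)] @ ?B)"
      using ok_exchange[of "[(Cap, 1)]" 1 5 ?B 3 1 Cup 0 1 Cup, OF _ B] by simp
    then have "ok ([] @ [(Cup, 3), (Cap, 1)] @ [(Cup, 1)] @ ?B)"
      using ok_exchange[of "[]" 3 3 "[(Cup, 1)] @ ?B" 1 1 Cap 0 3 Cup, OF _ B'] by simp
    then show ?thesis by (simp add: b rot_embed embed_def)
  qed
qed

text \<open>Dually, a generator of the lower two strands is disjoint from the cap at the top and
  leaves on the right.\<close>

lemma ok_rot_right: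
  assumes "runs 3 d 3" "ok (rot 3 d)" "b = [(Cross s, 1)] \<or> b = [(Cap, 1), (Cup, 1)]"
  shows "ok (rot 3 (d @ b))"
proof -
  define A where "A = (Cup, 3) # shift 1 d"
  have A: "runs 3 A 5" unfolding A_def using runs_shift[OF assms(1), of 1 1] by simp
  have A': "runs 3 (A @ [(Cap, 2)]) 3" using runs_appendI[OF A, of "[(Cap, 2)]" 3] by simp
  have ok: "ok (rot 3 d @ c)" if "c \<in> blocks" for c
    using that rot_runs[OF assms(1)] assms(2) by (intro ok_append) (auto intro: runs_block ok_genword genword_block)
  from assms(3) show ?thesis
  proof
    assume b: "b = [(Cross s, 1)]"
    have "ok (A @ [(Cap, 0), (Cross s, 0)])"
      using ok[of "[(Cross s, 0)]"] by (auto simp: A_def rot_embed embed_def blocks_def)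
    then have "ok (A @ [(Cross s, 2), (Cap, 0)])"
      using ok_exchange[of A 5 3 "[]" 0 0 Cap 0 2 "Cross s", OF A] by simp
    then show ?thesis by (simp add: A_def b rot_embed embed_def numeral_2_eq_2)
  next
    assume b: "b = [(Cap, 1), (Cup, 1)]"
    have "ok (A @ [(Cap, 0), (Cap, 0)] @ [(Cup, 0)])"
      using ok[of "[(Cap, 0), (Cup, 0)]"] by (auto simp: A_def rot_embed embed_def blocks_def)
    moreover have "ok (A @ [(Cap, 0), (Cap, 0)] @ [(Cup, 0)]) \<longleftrightarrow> ok (A @ [(Cap, 2), (Cap, 0)] @ [(Cup, 0)])"
      by (rule ok_exchange[where k = 0, OF A]) simp_all
    moreover have "ok ((A @ [(Cap, 2)]) @ [(Cap, 0), (Cup, 0)] @ []) \<longleftrightarrow>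
        ok ((A @ [(Cap, 2)]) @ [(Cup, 2), (Cap, 0)] @ [])"
      by (rule ok_exchange[where k = 0, OF A']) simp_all
    ultimately have "ok ((A @ [(Cap, 2)]) @ [(Cup, 2), (Cap, 0)] @ [])"
      by simp
    then show ?thesis by (simp add: A_def b rot_embed embed_def numeral_2_eq_2)
  qed
qed

text \<open>Exchanging cup and cap shows the rotated identity to be a hook with unequal
  positions.\<close>

lemma ok_rot_Nil: "ok (rot 3 [])"
proof -
  have "ok ([] @ [(Cap, 0), (Cup, 1)] @ []) \<longleftrightarrow> ok ([] @ [(Cup, 3), (Cap, 0)] @ [])"
    by (rule ok_exchange[where k = 1 and w = 3 and w' = 3]) simp_all
  then show ?thesis using hook_word_ok[of "[]" "[]" 0 1] by (simp add: rot_def)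
qed

text \<open>The rotated diagram straightens to a product of \<open>S_1\<close> and
  \<open>S_2\<close> in this order with both signs reversed, as each crossing slides past one of the
  bends. The chain runs from that product back to the rotated diagram.\<close>

lemma ok_rot_S2S1: "ok (rot 3 [(Cross s, 1), (Cross s', 0)])"
proof -
  let ?s = "Cross (\<not> s)" and ?t = "Cross (\<not> s')"
  have "ok ([(?t, 0)] @ [(Cup, 2), (Cap, 1)] @ [(?s, 1)]) \<longleftrightarrow> ok ([(?t, 0)] @ [(?s, 1)])"
    by (rule ok_zigzag2[where w = 3]) simp_all
  moreover have "ok ([] @ [(?t, 0), (Cup, 2)] @ [(Cap, 1), (?s, 1)]) \<longleftrightarrow>
      ok ([] @ [(Cup, 2), (?t, 0)] @ [(Cap, 1), (?s, 1)])"
    by (rule ok_exchange[where k = 0 and w = 3 and w' = 5]) simp_all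
  moreover have "ok ([(Cup, 2), (?t, 0)] @ [(Cap, 1), (?s, 1)] @ []) \<longleftrightarrow>
      ok ([(Cup, 2), (?t, 0)] @ [(?s, 3), (Cap, 1)] @ [])"
    by (rule ok_exchange[where k = 0 and w = 5 and w' = 3]) simp_all
  moreover have "ok ([(Cup, 2)] @ [(?t, 0), (?s, 3)] @ [(Cap, 1)]) \<longleftrightarrow>
      ok ([(Cup, 2)] @ [(?s, 3), (?t, 0)] @ [(Cap, 1)])"
    by (rule ok_exchange[where k = 1 and w = 5 and w' = 5]) simp_all
  moreover have "ok ([(Cup, 2), (?s, 3)] @ [(Cross s', 1), (Cap, 0)] @ []) \<longleftrightarrow>
      ok ([(Cup, 2), (?s, 3)] @ [(?t, 0), (Cap, 1)] @ [])"
    using ok_slide_cap[of "[(Cup, 2), (?s, 3)]" 3 "[]" 0 1 "\<not> s'"] by simp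
  moreover have "ok ([] @ [(Cup, 3), (Cross s, 2)] @ [(Cross s', 1), (Cap, 0)]) \<longleftrightarrow>
      ok ([] @ [(Cup, 2), (?s, 3)] @ [(Cross s', 1), (Cap, 0)])"
    by (rule ok_slide_cup[where w = 3]) simp_all
  ultimately show ?thesis by (simp add: rot_def words numeral_2_eq_2)
qed

text \<open>The rotated diagram consists of three zigzags and straightens to the identity.\<close>

lemma ok_rot_U2U1: "ok (rot 3 [(Cap, 1), (Cup, 1), (Cap, 0), (Cup, 0)])"
proof -
  have "ok ([] @ [(Cup, 3), (Cap, 2)] @ [(Cup, 2), (Cap, 1), (Cup, 1), (Cap, 0)]) \<longleftrightarrow>
      ok ([] @ [(Cup, 2), (Cap, 1), (Cup, 1), (Cap, 0)])"
    by (rule ok_zigzag2[where w = 3]) simp_all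
  moreover have "ok ([] @ [(Cup, 2), (Cap, 1)] @ [(Cup, 1), (Cap, 0)]) \<longleftrightarrow> ok ([] @ [(Cup, 1), (Cap, 0)])"
    by (rule ok_zigzag2[where w = 3]) simp_all
  moreover have "ok ([] @ [(Cup, 1), (Cap, 0)] @ []) \<longleftrightarrow> ok ([] @ [])"
    by (rule ok_zigzag2[where w = 3]) simp_all
  ultimately show ?thesis by (simp add: rot_def words numeral_2_eq_2)
qed

text \<open>The rotated diagram straightens to a single crossing \<open>S_1\<close> of opposite
  sign; in the next lemma it is \<open>S_2\<close>.\<close>

lemma ok_rot_U2S1: "ok (rot 3 [(Cap, 1), (Cup, 1), (Cross s, 0)])"
proof -
  let ?s = "Cross (\<not> s)"
  have "ok ([] @ [(Cup, 1), (Cap, 0)] @ [(?s, 0)]) \<longleftrightarrow> ok ([] @ [(?s, 0)])"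
    by (rule ok_zigzag2[where w = 3]) simp_all
  moreover have "ok ([(Cup, 1)] @ [(Cap, 0), (?s, 0)] @ []) \<longleftrightarrow> ok ([(Cup, 1)] @ [(?s, 2), (Cap, 0)] @ [])"
    by (rule ok_exchange[where k = 0 and w = 5 and w' = 3]) simp_all
  moreover have "ok ([] @ [(Cup, 2), (Cross s, 1)] @ [(Cap, 0)]) \<longleftrightarrow>
      ok ([] @ [(Cup, 1), (?s, 2)] @ [(Cap, 0)])"
    by (rule ok_slide_cup[where w = 3]) simp_all
  moreover have "ok ([] @ [(Cup, 3), (Cap, 2)] @ [(Cup, 2), (Cross s, 1), (Cap, 0)]) \<longleftrightarrow>
      ok ([] @ [(Cup, 2), (Cross s, 1), (Cap, 0)])"
    by (rule ok_zigzag2[where w = 3]) simp_all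
  ultimately show ?thesis by (simp add: rot_def words numeral_2_eq_2)
qed

lemma ok_rot_S2U1: "ok (rot 3 [(Cross s, 1), (Cap, 0), (Cup, 0)])"
proof -
  let ?s = "Cross (\<not> s)"
  have "ok ([(?s, 1)] @ [(Cup, 3), (Cap, 2)] @ []) \<longleftrightarrow> ok ([(?s, 1)] @ [])"
    by (rule ok_zigzag2[where w = 3]) simp_all
  moreover have "ok ([] @ [(?s, 1), (Cup, 3)] @ [(Cap, 2)]) \<longleftrightarrow> ok ([] @ [(Cup, 3), (?s, 1)] @ [(Cap, 2)])"
    by (rule ok_exchange[where k = 0 and w = 3 and w' = 5]) simp_all
  moreover have "ok ([(Cup, 3)] @ [(?s, 1), (Cap, 2)] @ []) \<longleftrightarrow> ok ([(Cup, 3)] @ [(Cross s, 2), (Cap, 1)] @ [])"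
    using ok_slide_cap[of "[(Cup, 3)]" 3 "[]" 1 2 "\<not> s"] by simp
  moreover have "ok ([(Cup, 3), (Cross s, 2), (Cap, 1)] @ [(Cup, 1), (Cap, 0)] @ []) \<longleftrightarrow>
      ok ([(Cup, 3), (Cross s, 2), (Cap, 1)] @ [])"
    by (rule ok_zigzag2[where w = 3]) simp_all
  ultimately show ?thesis by (simp add: rot_def words numeral_2_eq_2)
qed

text \<open>Index 1 is peeled off on the left and index 2 on the right. What remains is the identity
  or a word of length two that starts with index 2 and ends with index 1, and these have been
  computed.\<close>

lemma ok_rot_basic:
  assumes "b \<in> basic"
  shows "ok (rot 3 b)"
proof -
  have S2: "ok (rot 3 [(Cross s, 1)])" for s
    using ok_rot_right[of "[]" "[(Cross s, 1)]" s] ok_rot_Nil by simp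
  have U2: "ok (rot 3 [(Cap, 1), (Cup, 1)])"
    using ok_rot_right[of "[]" "[(Cap, 1), (Cup, 1)]"] ok_rot_Nil by simp
  note start = ok_rot_Nil S2 U2 ok_rot_S2S1 ok_rot_U2U1 ok_rot_U2S1 ok_rot_S2U1
  have bab: "ok (rot 3 [(Cross s, 1), (Cross s', 0), (Cross s'', 1)])" for s s' s''
    using ok_rot_right[of "[(Cross s, 1), (Cross s', 0)]" "[(Cross s'', 1)]" s''] ok_rot_S2S1 by simp
  have left: "ok (rot 3 ((Cross s, 0) # d))" "ok (rot 3 ((Cap, 0) # (Cup, 0) # d))"
    if "runs 3 d 3" "ok (rot 3 d)" for s d
    using ok_rot_left[OF that, of "[(Cross s, 0)]" s] ok_rot_left[OF that, of "[(Cap, 0), (Cup, 0)]"]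
    by simp_all
  show ?thesis
    using assms left start bab
    by (auto simp: basic_def basic_inv_def basic_noninv_def S_def U_def twist_inf_def)
qed

lemma ok_rot_power:
  assumes "runs 3 d 3" "ok d"
  shows "ok ((rot 3 ^^ i) d) \<and> runs 3 ((rot 3 ^^ i) d) 3"
  by (induction i) (auto simp: assms intro: ok_rot ok_rot_basic rot_runs)

section \<open>Diagrams with at most one crossing\<close>

text \<open>The sum of the widths in front of the slices, which decreases when a local maximum of the
  width is removed.\<close>

fun area :: "nat \<Rightarrow> diagram \<Rightarrow> nat" where
  "area m [] = 0"
| "area m ((f, i) # d) = m + area (m - ins f + outs f) d"

lemma area_append: "runs m A w \<Longrightarrow> area m (A @ B) = area m A + area w B"
  by (induction rule: runs.induct) auto

lemma crossings_append [simp]: "crossings (A @ B) = crossings A + crossings B"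
  by (simp add: crossings_def)

lemma crossings_simps [simp]:
  "crossings [] = 0" "crossings ((Cup, i) # d) = crossings d" "crossings ((Cap, i) # d) = crossings d"
  "crossings ((Cross s, i) # d) = Suc (crossings d)"
  by (simp_all add: crossings_def)

text \<open>Equal positions give a circle, adjacent ones a zigzag, and distant ones let the cap move
  in front of the cup. The bound \<open>2 * w + 2\<close> is the area of the peak itself.\<close>

lemma ok_cup_cap:
  assumes A: "runs 3 A w" and B: "runs w B 3" and i: "i \<le> w" and k: "k \<le> w"
    and less: "\<And>u. runs w u w \<Longrightarrow> area w u < 2 * w + 2 \<Longrightarrow> crossings u = 0 \<Longrightarrow> ok (A @ u @ B)"
  shows "ok (A @ [(Cup, i), (Cap, k)] @ B)"
proof -
  have AB: "ok (A @ B)" using less[of "[]"] by simp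
  consider "k = i" | "k = i + 1" | "i = k + 1" | m where "k = i + 2 + m" | m where "i = k + 2 + m"
  proof -
    have "k = i \<or> k = i + 1 \<or> i = k + 1 \<or> i + 2 \<le> k \<or> k + 2 \<le> i" by arith
    then show thesis using that le_Suc_ex by metis
  qed
  then show ?thesis
  proof cases
    case 1
    then show ?thesis using reduces_circle[OF A i B AB] by simp
  next
    case 2
    then show ?thesis using reduces_move[OF zigzag1[of i] A, of w B basic] B AB k by simp
  next
    case 3
    then show ?thesis using ok_zigzag2[OF A B, of k i] AB i by simp
  next
    case (4 m)
    have "ok (A @ [(Cap, i + m), (Cup, i)] @ B)"
      using 4 k by (intro less) auto
    moreover have "ok (A @ [(Cup, i), (Cap, k)] @ B) \<longleftrightarrow> ok (A @ [(Cap, i + m), (Cup, i)] @ B)"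
      by (rule ok_exchange[where k = m, OF A B]) (use 4 k in auto)
    ultimately show ?thesis by simp
  next
    case (5 m)
    have "ok (A @ [(Cap, k), (Cup, k + m)] @ B)"
      using 5 i by (intro less) auto
    moreover have "ok (A @ [(Cap, k), (Cup, k + m)] @ B) \<longleftrightarrow> ok (A @ [(Cup, i), (Cap, k)] @ B)"
      by (rule ok_exchange[where k = m, OF A B]) (use 5 i in auto)
    ultimately show ?thesis by simp
  qed
qed

text \<open>The crossing joins the lower strand of the cup to the strand below. A cap meeting the
  crossing turns it into a kink or lets it slide clear of the cup; any other cap passes in front of
  the crossing. The three slices have area \<open>3 * w + 4\<close>.\<close>

lemma ok_cup_cross_cap_below:
  assumes A: "runs 3 A w" and B: "runs w B 3" and i: "i + 1 \<le> w" and k: "k \<le> w"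
    and less: "\<And>u. runs w u w \<Longrightarrow> area w u < 3 * w + 4 \<Longrightarrow> crossings u \<le> 1 \<Longrightarrow> ok (A @ u @ B)"
  shows "ok (A @ [(Cup, i), (Cross s, i + 1), (Cap, k)] @ B)"
proof -
  let ?A = "A @ [(Cup, i)]"
  have A': "runs 3 ?A (w + 2)" using runs_appendI[OF A, of "[(Cup, i)]"] i by simp
  have less_peak: "ok (A @ [(Cup, i'), (Cap, k')] @ B)" if "i' \<le> w" "k' \<le> w" for i' k'
    using that by (intro less) auto
  consider "k = i" | "k = i + 1" | "k = i + 2" | m where "k = i + 1 + 2 + m" | m where "i + 1 = k + 2 + m"
  proof -
    have "k = i \<or> k = i + 1 \<or> k = i + 2 \<or> i + 1 + 2 \<le> k \<or> k + 2 \<le> i + 1" by arith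
    then show thesis using that le_Suc_ex by metis
  qed
  then show ?thesis
  proof cases
    case 1
    have "ok (?A @ [(Cross (\<not> s), i), (Cap, i + 1)] @ B) \<longleftrightarrow> ok (?A @ [(Cross s, i + 1), (Cap, i)] @ B)"
      using ok_slide_cap[OF A' B, of i "i + 1" "\<not> s"] i by simp
    moreover have "ok (A @ [(Cup, i), (Cross (\<not> s), i)] @ [(Cap, i + 1)] @ B) \<longleftrightarrow>
        ok (A @ [(Cup, i)] @ [(Cap, i + 1)] @ B)"
      by (rule reduces_kink_cup[OF A]) (use i B in auto)
    ultimately show ?thesis using less_peak[of i "i + 1"] 1 i by simp
  next
    case 2
    have "ok (?A @ [(Cross s, i + 1), (Cap, i + 1)] @ B) \<longleftrightarrow> ok (?A @ [(Cap, i + 1)] @ B)"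
      by (rule reduces_kink_cap[OF A' i B])
    then show ?thesis using less_peak[of i "i + 1"] 2 i by simp
  next
    case 3
    have "ok (?A @ [(Cross s, i + 1), (Cap, i + 2)] @ B) \<longleftrightarrow>
        ok (?A @ [(Cross (\<not> s), i + 2), (Cap, i + 1)] @ B)"
      by (rule ok_slide_cap[OF A' B]) (use 3 k in auto)
    moreover have "ok (A @ [(Cup, i), (Cross (\<not> s), i + 2)] @ [(Cap, i + 1)] @ B) \<longleftrightarrow>
        ok (A @ [(Cross (\<not> s), i), (Cup, i)] @ [(Cap, i + 1)] @ B)"
      by (rule ok_exchange[where k = 0 and w' = "w + 2", OF A]) (use 3 k B in auto)
    \<comment> \<open>The peak remains, but the crossing now sits in front of the cup, where the
      width is smaller by two.\<close>
    moreover have "ok (A @ [(Cross (\<not> s), i), (Cup, i), (Cap, i + 1)] @ B)"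
      using 3 k by (intro less) auto
    ultimately show ?thesis using 3 by simp
  next
    case (4 m)
    have "ok (?A @ [(Cross s, i + 1), (Cap, k)] @ B) \<longleftrightarrow> ok (?A @ [(Cap, k), (Cross s, i + 1)] @ B)"
      by (rule ok_exchange[where k = m, OF A' B]) (use 4 k in auto)
    moreover have "ok (A @ [(Cup, i), (Cap, k), (Cross s, i + 1)] @ B)"
      using 4 k by (intro less) auto
    ultimately show ?thesis by simp
  next
    case (5 m)
    have "ok (?A @ [(Cap, k), (Cross s, k + m)] @ B) \<longleftrightarrow> ok (?A @ [(Cross s, i + 1), (Cap, k)] @ B)"
      by (rule ok_exchange[where k = m, OF A' B]) (use 5 i in auto)
    moreover have "ok (A @ [(Cup, i), (Cap, k), (Cross s, k + m)] @ B)"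
      using 5 i by (intro less) auto
    ultimately show ?thesis by simp
  qed
qed

text \<open>A crossing of the two new strands is a kink, one disjoint from the cup moves in front of
  it, and one with the strand above slides to the position treated before.\<close>

lemma ok_cup_cross_cap:
  assumes A: "runs 3 A w" and B: "runs w B 3" and i: "i \<le> w" and j: "j \<le> w" and k: "k \<le> w"
    and less: "\<And>u. runs w u w \<Longrightarrow> area w u < 3 * w + 4 \<Longrightarrow> crossings u \<le> 1 \<Longrightarrow> ok (A @ u @ B)"
  shows "ok (A @ [(Cup, i), (Cross s, j), (Cap, k)] @ B)"
proof -
  have B': "runs (w + 2) ([(Cap, k)] @ B) 3" using B k by simp
  consider "j = i" | "j = i + 1" | "i = j + 1" | m where "j = i + 2 + m" | m where "i = j + 2 + m"
  proof -
    have "j = i \<or> j = i + 1 \<or> i = j + 1 \<or> i + 2 \<le> j \<or> j + 2 \<le> i" by arith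
    then show thesis using that le_Suc_ex by metis
  qed
  then show ?thesis
  proof cases
    case 1
    have "ok (A @ [(Cup, i), (Cap, k)] @ B)" using i k by (intro less) auto
    then show ?thesis using reduces_kink_cup[OF A i B', of basic s] 1 by simp
  next
    case 2
    then show ?thesis using ok_cup_cross_cap_below[OF A B _ k less, of i s] j by simp
  next
    case 3
    have "ok (A @ [(Cup, i), (Cross s, j)] @ [(Cap, k)] @ B) \<longleftrightarrow>
        ok (A @ [(Cup, j), (Cross (\<not> s), i)] @ [(Cap, k)] @ B)"
      by (rule ok_slide_cup[OF A B']) (use 3 i in auto)
    then show ?thesis using ok_cup_cross_cap_below[OF A B _ k less, of j "\<not> s"] 3 i by simp
  next
    case (4 m)
    have "ok (A @ [(Cup, i), (Cross s, j)] @ [(Cap, k)] @ B) \<longleftrightarrow>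
        ok (A @ [(Cross s, i + m), (Cup, i)] @ [(Cap, k)] @ B)"
      by (rule ok_exchange[where k = m, OF A B']) (use 4 j in auto)
    moreover have "ok (A @ [(Cross s, i + m), (Cup, i), (Cap, k)] @ B)"
      using 4 j k by (intro less) auto
    ultimately show ?thesis by simp
  next
    case (5 m)
    have "ok (A @ [(Cross s, j), (Cup, i)] @ [(Cap, k)] @ B) \<longleftrightarrow>
        ok (A @ [(Cup, i), (Cross s, j)] @ [(Cap, k)] @ B)"
      by (rule ok_exchange[where k = m, OF A B']) (use 5 i in auto)
    moreover have "ok (A @ [(Cross s, j), (Cup, i), (Cap, k)] @ B)"
      using 5 i k by (intro less) auto
    ultimately show ?thesis by simp
  qed
qed

text \<open>A width that rises and later falls has a local maximum, where only crossings separate a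
  cup from the next cap. Without one, every cap precedes every cup.\<close>

lemma peak_cases:
  obtains A i M k B where "d = A @ [(Cup, i)] @ M @ [(Cap, k)] @ B" "\<And>x. x \<in> set M \<Longrightarrow> is_crossing x"
  | C D where "d = C @ D" "\<And>i. (Cup, i) \<notin> set C" "\<And>i. (Cap, i) \<notin> set D"
proof -
  have "(\<exists>A i M k B. d = A @ [(Cup, i)] @ M @ [(Cap, k)] @ B \<and> (\<forall>x\<in>set M. is_crossing x)) \<or>
    (\<exists>C D. d = C @ D \<and> (\<forall>i. (Cup, i) \<notin> set C) \<and> (\<forall>i. (Cap, i) \<notin> set D))"
  proof (induction d)
    case (Cons x d)
    from Cons show ?case
    proof
      assume "\<exists>A i M k B. d = A @ [(Cup, i)] @ M @ [(Cap, k)] @ B \<and> (\<forall>x\<in>set M. is_crossing x)"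
      then show ?thesis by (metis append_Cons)
    next
      assume "\<exists>C D. d = C @ D \<and> (\<forall>i. (Cup, i) \<notin> set C) \<and> (\<forall>i. (Cap, i) \<notin> set D)"
      then obtain C D where CD: "d = C @ D" "\<And>i. (Cup, i) \<notin> set C" "\<And>i. (Cap, i) \<notin> set D"
        by blast
      show ?thesis
      proof (cases "fst x = Cup")
        case False
        then have "x # d = (x # C) @ D" "\<forall>i. (Cup, i) \<notin> set (x # C)" using CD by auto
        then show ?thesis using CD by blast
      next
        case True
        then obtain i where x: "x = (Cup, i)" by (cases x) auto
        show ?thesis
        proof (cases "\<exists>k. (Cap, k) \<in> set C")
          case True
          \<comment> \<open>\<open>C\<close> has no cups, so only crossings precede its first
            cap.\<close>
          then obtain M y C' where C: "C = M @ y # C'" "\<exists>k. y = (Cap, k)"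
              "\<forall>z\<in>set M. \<not> (\<exists>k. z = (Cap, k))"
            using split_list_first_prop[of C "\<lambda>z. \<exists>k. z = (Cap, k)"] by blast
          have "is_crossing z" if "z \<in> set M" for z
            using that C CD(2) by (cases z rule: is_crossing.cases) auto
          then show ?thesis using C(1,2) CD(1) x by (metis append.assoc append_Cons append_Nil)
        next
          case False
          then have "x # d = [] @ (x # C @ D)" "\<forall>i. (Cap, i) \<notin> set (x # C @ D)" using CD x by auto
          then show ?thesis by (metis empty_iff empty_set)
        qed
      qed
    qed
  qed simp
  then show thesis using that by blast
qed

lemma slice_cases:
  fixes x :: slice
  obtains (Cross) s i where "x = (Cross s, i)" | (Cup) i where "x = (Cup, i)"
    | (Cap) i where "x = (Cap, i)"
  by (cases x rule: is_crossing.cases) auto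

text \<open>The width can only drop, and from three at most once: on a single strand neither a
  crossing nor a cap fits, so the cap comes last.\<close>

lemma no_cup_cases:
  assumes "runs 3 C w" "\<And>i. (Cup, i) \<notin> set C"
  shows "(w = 3 \<and> braid C) \<or> (w = 1 \<and> (\<exists>A i. C = A @ [(Cap, i)] \<and> braid A \<and> i \<le> 1))"
  using assms
proof (induction C)
  case (Cons x C)
  show ?case
  proof (cases x rule: slice_cases)
    case (Cross s i)
    then have i: "i \<le> 1" and C: "runs 3 C w" using Cons.prems(1) by (auto simp: numeral_3_eq_3)
    from Cons.IH[OF C] Cons.prems(2) consider "w = 3" "braid C"
      | A k where "w = 1" "C = A @ [(Cap, k)]" "braid A" "k \<le> 1"
      by (metis list.set_intros(2))
    then show ?thesis
    proof cases
      case 2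
      then have "x # C = (x # A) @ [(Cap, k)]" "braid (x # A)" using Cross i by auto
      then show ?thesis using 2 by blast
    qed (use Cross i in auto)
  next
    case (Cup i)
    then show ?thesis using Cons.prems(2) by auto
  next
    case (Cap i)
    then have i: "i \<le> 1" and C: "runs 1 C w" using Cons.prems(1) by (auto simp: numeral_3_eq_3)
    have "C = []"
    proof (cases C)
      case (Cons y C')
      then have "(Cup, snd y) \<noteq> y" using Cons.prems by (cases y) auto
      then show ?thesis using C Cons by (cases y rule: slice_cases) auto
    qed
    then show ?thesis using C Cap i by (intro disjI2) (auto intro!: exI[of _ "[]"])
  qed
qed simp

lemma no_cap_runs_ge: "runs w D n \<Longrightarrow> (\<And>i. (Cap, i) \<notin> set D) \<Longrightarrow> w \<le> n"
proof (induction rule: runs.induct)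
  case (runs_Cons i f m d n)
  then show ?case by (cases f) auto
qed simp

lemma no_cap_braid:
  assumes "runs 3 D 3" "\<And>i. (Cap, i) \<notin> set D"
  shows "braid D"
  using assms
proof (induction D)
  case (Cons x D)
  show ?case
  proof (cases x rule: slice_cases)
    case (Cross s i)
    then have "i \<le> 1" "runs 3 D 3" using Cons.prems(1) by (auto simp: numeral_3_eq_3)
    then show ?thesis using Cross Cons by simp
  next
    case (Cup i)
    then show ?thesis using Cons.prems no_cap_runs_ge[of 5 D 3] by auto
  qed (use Cons.prems in auto)
qed simp

text \<open>A peak is replaced by something of smaller area until none is left. The diagram is then
  a braid word, or braid words around one cap followed by one cup.\<close>

lemma ok_few_crossings:
  assumes "runs 3 d 3" "crossings d \<le> 1"
  shows "ok d"
  using assms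
proof (induction "area 3 d" arbitrary: d rule: less_induct)
  case less
  show ?case
  proof (cases d rule: peak_cases)
    case (1 A i M k B)
    obtain w where A: "runs 3 A w" and i: "i \<le> w" and r: "runs (w + 2) (M @ [(Cap, k)] @ B) 3"
      using less.prems(1) unfolding 1 by (auto simp: runs_append)
    let ?p = "[(Cup, i)] @ M @ [(Cap, k)]"
    have M: "crossings M = length M" using 1(2) by (simp add: crossings_def filter_id_conv)
    have len: "length M \<le> 1" using less.prems(2) M unfolding 1 by simp
    then have M_cases: "M = [] \<or> (\<exists>s j. M = [(Cross s, j)])"
      using 1(2) by (cases M) (auto elim: is_crossing.elims)
    \<comment> \<open>The area formula covers both kinds of peak and gives the bounds
      \<open>2 * w + 2\<close> and \<open>3 * w + 4\<close> of the preceding lemmas.\<close>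
    then have B: "runs w B 3" and p: "runs w ?p w"
      and area_p: "area w ?p = (length M + 2) * w + 2 * length M + 2"
      using r i by auto
    have smaller: "ok (A @ u @ B)"
      if u: "runs w u w" "area w u < area w ?p" "crossings u \<le> length M" for u
    proof (rule less.hyps)
      show "runs 3 (A @ u @ B) 3" using A u(1) B by (intro runs_appendI)
      have "area 3 d = area 3 A + (area w ?p + area w B)"
        using area_append[OF A, of "?p @ B"] area_append[OF p, of B] 1(1) by simp
      then show "area 3 (A @ u @ B) < area 3 d"
        using area_append[OF A, of "u @ B"] area_append[OF u(1), of B] u(2) by simp
      show "crossings (A @ u @ B) \<le> 1" using less.prems(2) u(3) M unfolding 1 by simp
    qed
    from M_cases show ?thesis
    proof
      assume M: "M = []"
      then have "k \<le> w" using r by simp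
      then have "ok (A @ [(Cup, i), (Cap, k)] @ B)"
        by (intro ok_cup_cap[OF A B i] smaller) (simp_all add: M)
      then show ?thesis using 1 M by simp
    next
      assume "\<exists>s j. M = [(Cross s, j)]"
      then obtain s j where M: "M = [(Cross s, j)]" by blast
      then have "j \<le> w" "k \<le> w" using r by auto
      then have "ok (A @ [(Cup, i), (Cross s, j), (Cap, k)] @ B)"
        by (intro ok_cup_cross_cap[OF A B i] smaller) (simp_all add: M)
      then show ?thesis using 1 M by simp
    qed
  next
    case (2 C D)
    then obtain w where C: "runs 3 C w" and D: "runs w D 3"
      using less.prems(1) by (auto simp: runs_append)
    from no_cup_cases[OF C 2(2)] show ?thesis
    proof (elim disjE conjE exE)
      assume "w = 3" "braid C"
      then have "braid d" using no_cap_braid[of D] D 2 by simp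
      then show ?thesis by (intro ok_genword braid_genword)
    next
      fix A i assume w: "w = 1" and A: "C = A @ [(Cap, i)]" "braid A" "i \<le> 1"
      show ?thesis
      proof (cases D)
        \<comment> \<open>On one strand the only slice that fits is a cup.\<close>
        case (Cons y D')
        then obtain j where y: "y = (Cup, j)" "j \<le> 1" and D': "runs 3 D' 3"
          using D w 2(3) by (cases y rule: slice_cases) (auto simp: numeral_3_eq_3)
        have "braid D'" using D' 2(3) Cons by (intro no_cap_braid) auto
        then show ?thesis
          using hook_word_ok[of A D' i j] A y 2(1) Cons braid_genword by simp
      qed (use D w in simp)
    qed
  qed
qed

section \<open>Algebraic tangles\<close>

lemma algebraic_span:
  assumes "T \<in> algebraic 3"
  shows "Poly_Mapping.single T 1 \<in> free.span (relators 3 \<union> gen 3 ` basic)"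
  using assms
proof induction
    case (few_crossings d)
    then show ?case
      using ok_few_crossings[of d] by (simp add: reduces_def gen_def diagrams_def)
  next
    case (product d d' i j)
    then have "ok d" "ok d'" by (simp_all add: reduces_def gen_def)
    then have "ok ((rot 3 ^^ i) d @ (rot 3 ^^ j) d')"
      using ok_rot_power[of d i] ok_rot_power[of d' j] product by (intro ok_append) (auto simp: diagrams_def)
    then show ?case by (simp add: reduces_def gen_def)
qed

text \<open>The elements that are combinations of \<open>Bs\<close> modulo relators form a submodule
  containing both the relators and the generators.\<close>

lemma span_gen_combination:
  assumes "finite Bs" "x \<in> free.span (relators n \<union> gen n ` Bs)"
  shows "\<exists>c. skein_eq n x (\<Sum>d\<in>Bs. scale (c d) (gen n d))"
proof -
  let ?S = "{x. \<exists>c. skein_eq n x (\<Sum>d\<in>Bs. scale (c d) (gen n d))}"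
  have "free.subspace ?S"
  proof (rule free.subspaceI)
    show "0 \<in> ?S"
      by (auto simp: skein_eq_def free.span_zero intro!: exI[of _ "\<lambda>_. 0"])
  next
    fix x y assume "x \<in> ?S" "y \<in> ?S"
    then obtain c c' where
      "x - (\<Sum>d\<in>Bs. scale (c d) (gen n d)) \<in> free.span (relators n)"
      "y - (\<Sum>d\<in>Bs. scale (c' d) (gen n d)) \<in> free.span (relators n)"
      by (auto simp: skein_eq_def)
    then have "(x - (\<Sum>d\<in>Bs. scale (c d) (gen n d))) + (y - (\<Sum>d\<in>Bs. scale (c' d) (gen n d)))
        \<in> free.span (relators n)"
      by (rule free.span_add)
    then have "skein_eq n (x + y) (\<Sum>d\<in>Bs. scale (c d + c' d) (gen n d))"
      by (simp add: skein_eq_def free.scale_left_distrib sum.distrib algebra_simps)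
    then show "x + y \<in> ?S" by (intro CollectI exI)
  next
    fix r x assume "x \<in> ?S"
    then obtain c where "x - (\<Sum>d\<in>Bs. scale (c d) (gen n d)) \<in> free.span (relators n)"
      by (auto simp: skein_eq_def)
    then have "scale r (x - (\<Sum>d\<in>Bs. scale (c d) (gen n d))) \<in> free.span (relators n)"
      by (rule free.span_scale)
    then have "skein_eq n (scale r x) (\<Sum>d\<in>Bs. scale (r * c d) (gen n d))"
      by (simp add: skein_eq_def free.scale_right_diff_distrib free.scale_sum_right)
    then show "scale r x \<in> ?S" by (intro CollectI exI)
  qed
  moreover have "relators n \<union> gen n ` Bs \<subseteq> ?S"
  proof (intro Un_least subsetI)
    fix x assume "x \<in> relators n"
    then show "x \<in> ?S"
      by (auto simp: skein_eq_def intro!: exI[of _ "\<lambda>_. 0"] free.span_base)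
  next
    fix x assume "x \<in> gen n ` Bs"
    then obtain d where "d \<in> Bs" "x = gen n d" by blast
    then have "(\<Sum>e\<in>Bs. scale (if e = d then 1 else 0) (gen n e)) = x"
      using assms(1) by (simp add: if_distrib[of "\<lambda>c. scale c _"] sum.delta cong: if_cong)
    then show "x \<in> ?S"
      by (auto simp: skein_eq_def free.span_zero intro!: exI[of _ "\<lambda>e. if e = d then 1 else 0"])
  qed
  ultimately show ?thesis using free.span_minimal assms(2) by blast
qed

text \<open>An infinite set has \<open>card\<close> equal to 0, so the counts 24 and 16 already give
  finiteness.\<close>

lemma finite_basic: "finite basic"
  using card_basic_inv card_basic_noninv card.infinite by (fastforce simp: basic_def)

theorem theorem10p5:
  assumes "T \<in> algebraic 3"
  shows "\<exists>c :: diagram \<Rightarrow> R.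
    skein_eq 3 (Poly_Mapping.single T 1)
      (\<Sum>d \<in> basic_inv \<union> basic_noninv. scale (c d) (gen 3 d))"
  using span_gen_combination[OF finite_basic] algebraic_span[OF assms]
  by (simp flip: basic_def)

end
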